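(* Let $\mathcal{A}$ be an abelian category and $\mathcal{D}$ an additive category. Assume we have adjunctions $f_!\dashv f^*\dashv f_*$ where $f^*\colon\mathcal{A}\to\mathcal{D}$ is a faithful functor. Furthermore, let $E\colon\operatorname{im}f_!\to\operatorname{im}f_*$ be an isomorphism of categories satisfying $E\circ f_!=f_*$. The following holds: (1) There exists a Nakayama functor $\nu$ relative to $f_!\dashv f^*$ which satisfies $\nu|_{\operatorname{im}f_!}=E$; (2) If $\nu'$ is any other right exact functor satisfying $\nu'|_{\operatorname{im}f_!}=E$, then there exists a unique isomorphism $\zeta\colon\nu\to\nu'$ satisfying $\zeta_{f_!}=1_{f_*}$.
   Context: All categories are preadditive and all functors additive. For a functor $F\colon\mathcal{D}\to\mathcal{E}$, $\operatorname{im}F$ is the category with the same objects as $\mathcal{D}$, where a morphism from $D_1$ to $D_2$ is a morphism $F(D_1)\to F(D_2)$ in $\mathcal{E}$; $F$ is also regarded as a functor $\mathcal{D}\to\operatorname{im}F$ that is the identity on objects. Thus $E\circ f_!=f_*$ means that $E$ is the identity on objects and $E(f_!(d))=f_*(d)$ for every morphism $d$ of $\mathcal{D}$. A Nakayama functor relative to $f_!\dashv f^*$ is a functor $\nu\colon\mathcal{A}\to\mathcal{A}$ with a right adjoint $\nu^-$ such that (1) $\nu\circ f_!$ is right adjoint to $f^*$; (2) the unit of $\nu\dashv\nu^-$ precomposed with $f_!$ is an isomorphism $f_!\to\nu^-\circ\nu\circ f_!$. For a functor $\nu\colon\mathcal{A}\to\mathcal{A}$, $\nu|_{\operatorname{im}f_!}=E$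 means $\nu(f_!(D))=f_*(D)$ for all $D$ and $\nu(g)=E(g)$ for all $g\colon f_!(D_1)\to f_!(D_2)$ in $\mathcal{A}$. The equality $\nu\circ f_!=f_*$ is understood as a specified identification: a natural isomorphism $\iota\colon\nu\circ f_!\to f_*$, part of the data, with $\iota_{D_2}\circ\nu(g)=E(g)\circ\iota_{D_1}$ for all $g\colon f_!(D_1)\to f_!(D_2)$; and for $\nu,\nu'$ with identifications $\iota,\iota'$, the condition $\zeta_{f_!}=1_{f_*}$ means $\iota'_D\circ\zeta_{f_!(D)}=\iota_D$ for all $D\in\mathcal{D}$. ($\zeta_{f_!}$ denotes $\zeta$ precomposed with $f_!$.) *)

theory Defs
  imports "HOL-Algebra.Group" "HOL-Library.FuncSet"
begin

section \<open>Preadditive categories\<close>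

text \<open>
  Morphism sets are indexed by their source and target and need not be disjoint. Accordingly
  composition takes the objects involved as arguments: for \<open>f\<close> from \<open>X\<close> to \<open>Y\<close> and \<open>g\<close> from \<open>Y\<close>
  to \<open>Z\<close>, the composite of \<open>g\<close> after \<open>f\<close> is \<open>Comp C X Y Z g f\<close>.
  The abelian group of morphisms is a structure of HOL-Algebra, which is written
  multiplicatively there: the product is the sum of morphisms, the unit is the zero morphism.
\<close>

record ('o, 'm) cat =
  Ob :: "'o set"
  HomG :: "'o \<Rightarrow> 'o \<Rightarrow> 'm monoid"
  Ident :: "'o \<Rightarrow> 'm"
  Comp :: "'o \<Rightarrow> 'o \<Rightarrow> 'o \<Rightarrow> 'm \<Rightarrow> 'm \<Rightarrow> 'm"

abbreviation Hom :: "('o, 'm) cat \<Rightarrow> 'o \<Rightarrow> 'o \<Rightarrow> 'm set"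
  where "Hom C X Y \<equiv> carrier (HomG C X Y)"

abbreviation zero_mor :: "('o, 'm) cat \<Rightarrow> 'o \<Rightarrow> 'o \<Rightarrow> 'm"
  where "zero_mor C X Y \<equiv> one (HomG C X Y)"

abbreviation add_mor :: "('o, 'm) cat \<Rightarrow> 'o \<Rightarrow> 'o \<Rightarrow> 'm \<Rightarrow> 'm \<Rightarrow> 'm"
  where "add_mor C X Y f g \<equiv> mult (HomG C X Y) f g"

locale preadditive_category =
  fixes C :: "('o, 'm) cat"
  assumes hom_group: "\<And>X Y. X \<in> Ob C \<Longrightarrow> Y \<in> Ob C \<Longrightarrow> comm_group (HomG C X Y)"
    and ident_in_hom: "\<And>X. X \<in> Ob C \<Longrightarrow> Ident C X \<in> Hom C X X"
    and comp_in_hom: "\<And>X Y Z g f. X \<in> Ob C \<Longrightarrow> Y \<in> Ob C \<Longrightarrow> Z \<in> Ob C \<Longrightarrow>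
      g \<in> Hom C Y Z \<Longrightarrow> f \<in> Hom C X Y \<Longrightarrow> Comp C X Y Z g f \<in> Hom C X Z"
    and comp_ident_left: "\<And>X Y f. X \<in> Ob C \<Longrightarrow> Y \<in> Ob C \<Longrightarrow> f \<in> Hom C X Y \<Longrightarrow>
      Comp C X Y Y (Ident C Y) f = f"
    and comp_ident_right: "\<And>X Y f. X \<in> Ob C \<Longrightarrow> Y \<in> Ob C \<Longrightarrow> f \<in> Hom C X Y \<Longrightarrow>
      Comp C X X Y f (Ident C X) = f"
    and comp_assoc: "\<And>W X Y Z h g f. W \<in> Ob C \<Longrightarrow> X \<in> Ob C \<Longrightarrow> Y \<in> Ob C \<Longrightarrow> Z \<in> Ob C \<Longrightarrow>
      h \<in> Hom C Y Z \<Longrightarrow> g \<in> Hom C X Y \<Longrightarrow> f \<in> Hom C W X \<Longrightarrow>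
      Comp C W X Z (Comp C X Y Z h g) f = Comp C W Y Z h (Comp C W X Y g f)"
    and comp_add_right: "\<And>X Y Z g. X \<in> Ob C \<Longrightarrow> Y \<in> Ob C \<Longrightarrow> Z \<in> Ob C \<Longrightarrow> g \<in> Hom C Y Z \<Longrightarrow>
      (\<lambda>f. Comp C X Y Z g f) \<in> hom (HomG C X Y) (HomG C X Z)"
    and comp_add_left: "\<And>X Y Z f. X \<in> Ob C \<Longrightarrow> Y \<in> Ob C \<Longrightarrow> Z \<in> Ob C \<Longrightarrow> f \<in> Hom C X Y \<Longrightarrow>
      (\<lambda>g. Comp C X Y Z g f) \<in> hom (HomG C Y Z) (HomG C X Z)"

definition is_iso :: "('o, 'm) cat \<Rightarrow> 'o \<Rightarrow> 'o \<Rightarrow> 'm \<Rightarrow> bool"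
  where "is_iso C X Y f \<longleftrightarrow> f \<in> Hom C X Y \<and>
    (\<exists>g \<in> Hom C Y X. Comp C X Y X g f = Ident C X \<and> Comp C Y X Y f g = Ident C Y)"

definition is_mono :: "('o, 'm) cat \<Rightarrow> 'o \<Rightarrow> 'o \<Rightarrow> 'm \<Rightarrow> bool"
  where "is_mono C X Y f \<longleftrightarrow> f \<in> Hom C X Y \<and>
    (\<forall>W \<in> Ob C. \<forall>g \<in> Hom C W X. \<forall>h \<in> Hom C W X.
       Comp C W X Y f g = Comp C W X Y f h \<longrightarrow> g = h)"

definition is_epi :: "('o, 'm) cat \<Rightarrow> 'o \<Rightarrow> 'o \<Rightarrow> 'm \<Rightarrow> bool"
  where "is_epi C X Y f \<longleftrightarrow> f \<in> Hom C X Y \<and>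
    (\<forall>Z \<in> Ob C. \<forall>g \<in> Hom C Y Z. \<forall>h \<in> Hom C Y Z.
       Comp C X Y Z g f = Comp C X Y Z h f \<longrightarrow> g = h)"

definition is_kernel :: "('o, 'm) cat \<Rightarrow> 'o \<Rightarrow> 'o \<Rightarrow> 'm \<Rightarrow> 'o \<Rightarrow> 'm \<Rightarrow> bool"
  \<comment> \<open>\<open>k\<close> from \<open>K\<close> to \<open>X\<close> is a kernel of \<open>f\<close> from \<open>X\<close> to \<open>Y\<close>\<close>
  where "is_kernel C X Y f K k \<longleftrightarrow> K \<in> Ob C \<and> k \<in> Hom C K X \<and>
    Comp C K X Y f k = zero_mor C K Y \<and>
    (\<forall>T \<in> Ob C. \<forall>t \<in> Hom C T X. Comp C T X Y f t = zero_mor C T Y \<longrightarrow>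
       (\<exists>!u. u \<in> Hom C T K \<and> Comp C T K X k u = t))"

definition is_cokernel :: "('o, 'm) cat \<Rightarrow> 'o \<Rightarrow> 'o \<Rightarrow> 'm \<Rightarrow> 'o \<Rightarrow> 'm \<Rightarrow> bool"
  \<comment> \<open>\<open>q\<close> from \<open>Y\<close> to \<open>Q\<close> is a cokernel of \<open>f\<close> from \<open>X\<close> to \<open>Y\<close>\<close>
  where "is_cokernel C X Y f Q q \<longleftrightarrow> Q \<in> Ob C \<and> q \<in> Hom C Y Q \<and>
    Comp C X Y Q q f = zero_mor C X Q \<and>
    (\<forall>T \<in> Ob C. \<forall>t \<in> Hom C Y T. Comp C X Y T t f = zero_mor C X T \<longrightarrow>
       (\<exists>!u. u \<in> Hom C Q T \<and> Comp C Y Q T u q = t))"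

definition is_zero_object :: "('o, 'm) cat \<Rightarrow> 'o \<Rightarrow> bool"
  where "is_zero_object C Z \<longleftrightarrow> Z \<in> Ob C \<and>
    (\<forall>X \<in> Ob C. (\<exists>!f. f \<in> Hom C X Z) \<and> (\<exists>!f. f \<in> Hom C Z X))"

definition is_biproduct ::
  "('o, 'm) cat \<Rightarrow> 'o \<Rightarrow> 'o \<Rightarrow> 'o \<Rightarrow> 'm \<Rightarrow> 'm \<Rightarrow> 'm \<Rightarrow> 'm \<Rightarrow> bool"
  where "is_biproduct C X Y P i j p q \<longleftrightarrow> P \<in> Ob C \<and>
    i \<in> Hom C X P \<and> j \<in> Hom C Y P \<and> p \<in> Hom C P X \<and> q \<in> Hom C P Y \<and>
    Comp C X P X p i = Ident C X \<and> Comp C Y P Y q j = Ident C Y \<and>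
    Comp C X P Y q i = zero_mor C X Y \<and> Comp C Y P X p j = zero_mor C Y X \<and>
    add_mor C P P (Comp C P X P i p) (Comp C P Y P j q) = Ident C P"

locale additive_category = preadditive_category +
  assumes ex_zero_object: "\<exists>Z. is_zero_object C Z"
    and ex_biproduct: "\<And>X Y. X \<in> Ob C \<Longrightarrow> Y \<in> Ob C \<Longrightarrow>
      \<exists>P i j p q. is_biproduct C X Y P i j p q"

locale abelian_category = additive_category +
  assumes ex_kernel: "\<And>X Y f. X \<in> Ob C \<Longrightarrow> Y \<in> Ob C \<Longrightarrow> f \<in> Hom C X Y \<Longrightarrow>
      \<exists>K k. is_kernel C X Y f K k"
    and ex_cokernel: "\<And>X Y f. X \<in> Ob C \<Longrightarrow> Y \<in> Ob C \<Longrightarrow> f \<in> Hom C X Y \<Longrightarrow>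
      \<exists>Q q. is_cokernel C X Y f Q q"
    and mono_is_kernel: "\<And>X Y f. X \<in> Ob C \<Longrightarrow> Y \<in> Ob C \<Longrightarrow> is_mono C X Y f \<Longrightarrow>
      \<exists>Z \<in> Ob C. \<exists>g \<in> Hom C Y Z. is_kernel C Y Z g X f"
    and epi_is_cokernel: "\<And>X Y f. X \<in> Ob C \<Longrightarrow> Y \<in> Ob C \<Longrightarrow> is_epi C X Y f \<Longrightarrow>
      \<exists>W \<in> Ob C. \<exists>g \<in> Hom C W X. is_cokernel C W X g Y f"

text \<open>
  Exactness of \<open>X \<rightarrow> Y \<rightarrow> Z\<close> at \<open>Y\<close>: the image of \<open>f\<close>, that is, the kernel \<open>k\<close> of a
  cokernel \<open>q\<close> of \<open>f\<close>, is the kernel of \<open>g\<close>.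
\<close>

definition exact_at :: "('o, 'm) cat \<Rightarrow> 'o \<Rightarrow> 'o \<Rightarrow> 'o \<Rightarrow> 'm \<Rightarrow> 'm \<Rightarrow> bool"
  where "exact_at C X Y Z f g \<longleftrightarrow> f \<in> Hom C X Y \<and> g \<in> Hom C Y Z \<and>
    (\<exists>Q q K k. is_cokernel C X Y f Q q \<and> is_kernel C Y Q q K k \<and> is_kernel C Y Z g K k)"

definition short_exact :: "('o, 'm) cat \<Rightarrow> 'o \<Rightarrow> 'o \<Rightarrow> 'o \<Rightarrow> 'm \<Rightarrow> 'm \<Rightarrow> bool"
  where "short_exact C X Y Z f g \<longleftrightarrow>
    is_mono C X Y f \<and> exact_at C X Y Z f g \<and> is_epi C Y Z g"


section \<open>Additive functors and natural transformations\<close>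

record ('o, 'm, 'p, 'n) functr =
  fob :: "'o \<Rightarrow> 'p"
  fmor :: "'o \<Rightarrow> 'o \<Rightarrow> 'm \<Rightarrow> 'n"

locale additive_functor = source: preadditive_category C + target: preadditive_category D
  for C :: "('o, 'm) cat" and D :: "('p, 'n) cat" +
  fixes F :: "('o, 'm, 'p, 'n) functr"
  assumes fob_in_Ob: "\<And>X. X \<in> Ob C \<Longrightarrow> fob F X \<in> Ob D"
    and fmor_hom: "\<And>X Y. X \<in> Ob C \<Longrightarrow> Y \<in> Ob C \<Longrightarrow>
      fmor F X Y \<in> hom (HomG C X Y) (HomG D (fob F X) (fob F Y))"
    and fmor_ident: "\<And>X. X \<in> Ob C \<Longrightarrow> fmor F X X (Ident C X) = Ident D (fob F X)"
    and fmor_comp: "\<And>X Y Z g f. X \<in> Ob C \<Longrightarrow> Y \<in> Ob C \<Longrightarrow> Z \<in> Ob C \<Longrightarrow>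
      g \<in> Hom C Y Z \<Longrightarrow> f \<in> Hom C X Y \<Longrightarrow>
      fmor F X Z (Comp C X Y Z g f) =
        Comp D (fob F X) (fob F Y) (fob F Z) (fmor F Y Z g) (fmor F X Y f)"

definition id_functor :: "('o, 'm, 'o, 'm) functr"
  where "id_functor = \<lparr>fob = (\<lambda>X. X), fmor = (\<lambda>X Y f. f)\<rparr>"

definition comp_functor ::
  "('p, 'n, 'q, 'r) functr \<Rightarrow> ('o, 'm, 'p, 'n) functr \<Rightarrow> ('o, 'm, 'q, 'r) functr"
    (infixr "\<circ>\<^sub>F" 60)
  where "G \<circ>\<^sub>F F = \<lparr>fob = (\<lambda>X. fob G (fob F X)),
    fmor = (\<lambda>X Y f. fmor G (fob F X) (fob F Y) (fmor F X Y f))\<rparr>"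

text \<open>Functors are total functions on types; they are compared on the source category only.\<close>

definition functor_eq ::
  "('o, 'm) cat \<Rightarrow> ('o, 'm, 'p, 'n) functr \<Rightarrow> ('o, 'm, 'p, 'n) functr \<Rightarrow> bool"
  where "functor_eq C F G \<longleftrightarrow> (\<forall>X \<in> Ob C. fob F X = fob G X) \<and>
    (\<forall>X \<in> Ob C. \<forall>Y \<in> Ob C. \<forall>f \<in> Hom C X Y. fmor F X Y f = fmor G X Y f)"

definition faithful :: "('o, 'm) cat \<Rightarrow> ('o, 'm, 'p, 'n) functr \<Rightarrow> bool"
  where "faithful C F \<longleftrightarrow> (\<forall>X \<in> Ob C. \<forall>Y \<in> Ob C. inj_on (fmor F X Y) (Hom C X Y))"

definition category_iso ::
  "('o, 'm) cat \<Rightarrow> ('p, 'n) cat \<Rightarrow> ('o, 'm, 'p, 'n) functr \<Rightarrow> bool"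
  where "category_iso C D F \<longleftrightarrow> additive_functor C D F \<and>
    (\<exists>G. additive_functor D C G \<and>
       functor_eq C (G \<circ>\<^sub>F F) id_functor \<and> functor_eq D (F \<circ>\<^sub>F G) id_functor)"

definition right_exact ::
  "('o, 'm) cat \<Rightarrow> ('p, 'n) cat \<Rightarrow> ('o, 'm, 'p, 'n) functr \<Rightarrow> bool"
  where "right_exact C D F \<longleftrightarrow> additive_functor C D F \<and>
    (\<forall>X \<in> Ob C. \<forall>Y \<in> Ob C. \<forall>Z \<in> Ob C. \<forall>f g. short_exact C X Y Z f g \<longrightarrow>
       exact_at D (fob F X) (fob F Y) (fob F Z) (fmor F X Y f) (fmor F Y Z g) \<and>
       is_epi D (fob F Y) (fob F Z) (fmor F Y Z g))"

definition nat_trans ::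
  "('o, 'm) cat \<Rightarrow> ('p, 'n) cat \<Rightarrow> ('o, 'm, 'p, 'n) functr \<Rightarrow> ('o, 'm, 'p, 'n) functr
    \<Rightarrow> ('o \<Rightarrow> 'n) \<Rightarrow> bool"
  where "nat_trans C D F G \<tau> \<longleftrightarrow>
    (\<forall>X \<in> Ob C. \<tau> X \<in> Hom D (fob F X) (fob G X)) \<and>
    (\<forall>X \<in> Ob C. \<forall>Y \<in> Ob C. \<forall>f \<in> Hom C X Y.
       Comp D (fob F X) (fob F Y) (fob G Y) (\<tau> Y) (fmor F X Y f) =
       Comp D (fob F X) (fob G X) (fob G Y) (fmor G X Y f) (\<tau> X))"

definition nat_iso ::
  "('o, 'm) cat \<Rightarrow> ('p, 'n) cat \<Rightarrow> ('o, 'm, 'p, 'n) functr \<Rightarrow> ('o, 'm, 'p, 'n) functr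
    \<Rightarrow> ('o \<Rightarrow> 'n) \<Rightarrow> bool"
  where "nat_iso C D F G \<tau> \<longleftrightarrow> nat_trans C D F G \<tau> \<and>
    (\<forall>X \<in> Ob C. is_iso D (fob F X) (fob G X) (\<tau> X))"

text \<open>
  \<open>adjunction C D L R \<eta> \<epsilon>\<close>: the functor \<open>L\<close> from \<open>C\<close> to \<open>D\<close> is left adjoint to \<open>R\<close>, with unit
  \<open>\<eta>\<close> and counit \<open>\<epsilon>\<close>; the last two conditions are the triangle identities.
\<close>

definition adjunction ::
  "('o, 'm) cat \<Rightarrow> ('p, 'n) cat \<Rightarrow> ('o, 'm, 'p, 'n) functr \<Rightarrow> ('p, 'n, 'o, 'm) functr
    \<Rightarrow> ('o \<Rightarrow> 'm) \<Rightarrow> ('p \<Rightarrow> 'n) \<Rightarrow> bool"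
  where "adjunction C D L R \<eta> \<epsilon> \<longleftrightarrow>
    additive_functor C D L \<and> additive_functor D C R \<and>
    nat_trans C C id_functor (R \<circ>\<^sub>F L) \<eta> \<and> nat_trans D D (L \<circ>\<^sub>F R) id_functor \<epsilon> \<and>
    (\<forall>X \<in> Ob C. Comp D (fob L X) (fob L (fob R (fob L X))) (fob L X)
       (\<epsilon> (fob L X)) (fmor L X (fob R (fob L X)) (\<eta> X)) = Ident D (fob L X)) \<and>
    (\<forall>Y \<in> Ob D. Comp C (fob R Y) (fob R (fob L (fob R Y))) (fob R Y)
       (fmor R (fob L (fob R Y)) Y (\<epsilon> Y)) (\<eta> (fob R Y)) = Ident C (fob R Y))"


section \<open>The category im F and Nakayama functors\<close>

definition im_category ::
  "('o, 'm) cat \<Rightarrow> ('p, 'n) cat \<Rightarrow> ('o, 'm, 'p, 'n) functr \<Rightarrow> ('o, 'n) cat"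
  where "im_category D A F = \<lparr>Ob = Ob D,
    HomG = (\<lambda>X Y. HomG A (fob F X) (fob F Y)),
    Ident = (\<lambda>X. Ident A (fob F X)),
    Comp = (\<lambda>X Y Z. Comp A (fob F X) (fob F Y) (fob F Z))\<rparr>"

text \<open>\<open>F\<close> regarded as a functor from its source category to \<open>im F\<close>\<close>

definition to_im :: "('o, 'm, 'p, 'n) functr \<Rightarrow> ('o, 'm, 'o, 'n) functr"
  where "to_im F = \<lparr>fob = (\<lambda>X. X), fmor = fmor F\<rparr>"

definition nakayama_functor ::
  "('a, 'm) cat \<Rightarrow> ('d, 'n) cat \<Rightarrow> ('d, 'n, 'a, 'm) functr \<Rightarrow> ('a, 'm, 'd, 'n) functr
    \<Rightarrow> ('a, 'm, 'a, 'm) functr \<Rightarrow> bool"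
  where "nakayama_functor A D fs fu \<nu> \<longleftrightarrow>
    (\<exists>\<nu>r \<eta> \<epsilon>. adjunction A A \<nu> \<nu>r \<eta> \<epsilon> \<and>
       (\<exists>\<eta>' \<epsilon>'. adjunction A D fu (\<nu> \<circ>\<^sub>F fs) \<eta>' \<epsilon>') \<and>
       nat_iso D A fs (\<nu>r \<circ>\<^sub>F \<nu> \<circ>\<^sub>F fs) (\<lambda>X. \<eta> (fob fs X)))"

text \<open>
  \<open>restricts_to A D fs ft E \<nu> \<iota>\<close>: the restriction of \<open>\<nu>\<close> to \<open>im fs\<close> is \<open>E\<close>, via the specified
  identification \<open>\<iota>\<close> of \<open>\<nu> \<circ> fs\<close> with \<open>ft\<close>. Here \<open>E\<close> goes from \<open>im fs\<close> to \<open>im ft\<close> and is the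
  identity on objects, so \<open>fmor E X Y g\<close> is a morphism from \<open>ft X\<close> to \<open>ft Y\<close>.
\<close>

definition restricts_to ::
  "('a, 'm) cat \<Rightarrow> ('d, 'n) cat \<Rightarrow> ('d, 'n, 'a, 'm) functr \<Rightarrow> ('d, 'n, 'a, 'm) functr
    \<Rightarrow> ('d, 'm, 'd, 'm) functr \<Rightarrow> ('a, 'm, 'a, 'm) functr \<Rightarrow> ('d \<Rightarrow> 'm) \<Rightarrow> bool"
  where "restricts_to A D fs ft E \<nu> \<iota> \<longleftrightarrow>
    nat_iso D A (\<nu> \<circ>\<^sub>F fs) ft \<iota> \<and>
    (\<forall>X \<in> Ob D. \<forall>Y \<in> Ob D. \<forall>g \<in> Hom A (fob fs X) (fob fs Y).
       Comp A (fob \<nu> (fob fs X)) (fob \<nu> (fob fs Y)) (fob ft Y)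
         (\<iota> Y) (fmor \<nu> (fob fs X) (fob fs Y) g) =
       Comp A (fob \<nu> (fob fs X)) (fob ft X) (fob ft Y) (fmor E X Y g) (\<iota> X))"

end

theory Submission
  imports Defs
begin

text \<open>
  Write \<open>P X = f_sh f_up X\<close> and \<open>Q X = f_st f_up X\<close>, where \<open>f_sh\<close>, \<open>f_up\<close>, \<open>f_st\<close> are
  the functors \<open>f\<^sub>!\<close>, \<open>f\<^sup>*\<close>, \<open>f\<^sub>*\<close>. Because \<open>f_up\<close> is faithful, the counit \<open>P X \<rightarrow> X\<close> is an epimorphism.
  Covering its kernel \<open>K\<close> by \<open>P K\<close> in the same way presents \<open>X\<close> as the cokernel of a morphism
  \<open>rel X\<close> from \<open>P K\<close> to \<open>P X\<close>, that is, of a morphism of \<open>im f_sh\<close>. A functor that extends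
  \<open>E\<close> and preserves this cokernel has to send \<open>X\<close> to the cokernel of \<open>E (rel X)\<close>. This forces
  the definition of \<open>\<nu>\<close>, and it is also the reason for uniqueness: a transformation between two such
  functors is determined on the objects \<open>P X\<close> by the identifications and descends uniquely to
  cokernels. Nakayama functors preserve the cokernel because they are left adjoints
  (\<open>nakayama_presented\<close>), right exact functors because the presentation is spliced from two short
  exact sequences (\<open>right_exact_presented\<close>).

  The other properties of \<open>\<nu>\<close> follow from one natural bijection, the relation \<open>mate\<close> below:
  a morphism \<open>\<nu> X \<rightarrow> f_st Z\<close> is a morphism \<open>Q X \<rightarrow> f_st Z\<close> that annihilates \<open>E (rel X)\<close>. As \<open>E\<close> is
  bijective on morphisms, this is a morphism \<open>P X \<rightarrow> f_sh Z\<close> that annihilates \<open>rel X\<close>, hence a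
  morphism \<open>X \<rightarrow> f_sh Z\<close>. For \<open>X = f_sh Z\<close> the identity corresponds to the identification
  \<open>\<iota>: \<nu> f_sh Z \<rightarrow> f_st Z\<close>, and its compatibility with \<open>E\<close> is naturality of the bijection. Through \<open>\<iota>\<close> the
  bijection also says that \<open>\<nu>\<close> maps \<open>Hom(X, f_sh Z)\<close> bijectively to \<open>Hom(\<nu> X, \<nu> f_sh Z)\<close>; for a left
  adjoint this is equivalent to invertibility of the unit at \<open>f_sh Z\<close>. Finally, \<open>B\<close> embeds into \<open>Q B\<close>
  as the kernel of a morphism \<open>e: Q B \<rightarrow> Q C\<close>, so morphisms \<open>\<nu> X \<rightarrow> B\<close> are morphisms
  \<open>\<nu> X \<rightarrow> Q B\<close> annihilated by \<open>e\<close>, hence morphisms \<open>X \<rightarrow> P B\<close> annihilated by the \<open>E\<close>-preimage of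
  \<open>e\<close>: the kernel of that preimage is the value at \<open>B\<close> of a right adjoint of \<open>\<nu>\<close>.
\<close>

section \<open>Preadditive and abelian categories\<close>

context preadditive_category
begin

lemmas [simp] = ident_in_hom comp_in_hom
lemmas [simp] = comp_ident_left comp_ident_right

lemma hom_is_group: "X \<in> Ob C \<Longrightarrow> Y \<in> Ob C \<Longrightarrow> group (HomG C X Y)"
  using hom_group by (simp add: comm_group_def)

lemma zero_in_hom [simp]: "X \<in> Ob C \<Longrightarrow> Y \<in> Ob C \<Longrightarrow> zero_mor C X Y \<in> Hom C X Y"
  by (simp add: hom_is_group group.is_monoid monoid.one_closed)

lemma add_in_hom [simp]:
  "X \<in> Ob C \<Longrightarrow> Y \<in> Ob C \<Longrightarrow> f \<in> Hom C X Y \<Longrightarrow> g \<in> Hom C X Y \<Longrightarrow> add_mor C X Y f g \<in> Hom C X Y"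
  by (simp add: hom_is_group group.is_monoid monoid.m_closed)

lemma comp_zero_right [simp]:
  assumes "X \<in> Ob C" "Y \<in> Ob C" "Z \<in> Ob C" "g \<in> Hom C Y Z"
  shows "Comp C X Y Z g (zero_mor C X Y) = zero_mor C X Z"
  by (rule hom_one[OF comp_add_right[OF assms] hom_is_group hom_is_group]) (fact assms)+

lemma comp_zero_left [simp]:
  assumes "X \<in> Ob C" "Y \<in> Ob C" "Z \<in> Ob C" "f \<in> Hom C X Y"
  shows "Comp C X Y Z (zero_mor C Y Z) f = zero_mor C X Z"
  by (rule hom_one[OF comp_add_left[OF assms] hom_is_group hom_is_group]) (fact assms)+

lemma comp_distrib_left:
  assumes "X \<in> Ob C" "Y \<in> Ob C" "Z \<in> Ob C" "h \<in> Hom C Y Z" "f \<in> Hom C X Y" "g \<in> Hom C X Y"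
  shows "Comp C X Y Z h (add_mor C X Y f g) = add_mor C X Z (Comp C X Y Z h f) (Comp C X Y Z h g)"
  by (rule hom_mult[OF comp_add_right[OF assms(1-4)] assms(5,6)])

lemma comp_distrib_right:
  assumes "X \<in> Ob C" "Y \<in> Ob C" "Z \<in> Ob C" "h \<in> Hom C X Y" "f \<in> Hom C Y Z" "g \<in> Hom C Y Z"
  shows "Comp C X Y Z (add_mor C Y Z f g) h = add_mor C X Z (Comp C X Y Z f h) (Comp C X Y Z g h)"
  by (rule hom_mult[OF comp_add_left[OF assms(1-4)] assms(5,6)])

text \<open>
  Stands in for subtraction: \<open>\<delta>\<close> is the difference of \<open>f\<close> and \<open>g\<close>.
\<close>

lemma equalized_differ_by_annihilated:
  assumes ob: "X \<in> Ob C" "Y \<in> Ob C" "Z \<in> Ob C"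
    and hom: "h \<in> Hom C Y Z" "f \<in> Hom C X Y" "g \<in> Hom C X Y"
    and eq: "Comp C X Y Z h f = Comp C X Y Z h g"
  obtains \<delta> where "\<delta> \<in> Hom C X Y" "Comp C X Y Z h \<delta> = zero_mor C X Z" "f = add_mor C X Y g \<delta>"
proof -
  interpret XY: group "HomG C X Y" using ob by (simp add: hom_is_group)
  interpret XZ: group "HomG C X Z" using ob by (simp add: hom_is_group)
  let ?\<delta> = "add_mor C X Y (m_inv (HomG C X Y) g) f"
  have \<delta>: "?\<delta> \<in> Hom C X Y" "f = add_mor C X Y g ?\<delta>"
    using hom XY.m_assoc[of g "m_inv (HomG C X Y) g" f] by auto
  have "Comp C X Y Z h g = add_mor C X Z (Comp C X Y Z h g) (Comp C X Y Z h ?\<delta>)"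
    using \<delta> comp_distrib_left[OF ob hom(1,3) \<delta>(1)] eq by simp
  hence "Comp C X Y Z h ?\<delta> = zero_mor C X Z"
    using ob hom \<delta>(1) XZ.r_cancel_one'[of "Comp C X Y Z h g" "Comp C X Y Z h ?\<delta>"] by (simp add: comp_in_hom)
  thus ?thesis using \<delta> that by blast
qed

lemma is_isoE:
  assumes "is_iso C X Y f"
  obtains g where "f \<in> Hom C X Y" "g \<in> Hom C Y X"
    "Comp C X Y X g f = Ident C X" "Comp C Y X Y f g = Ident C Y"
  using assms unfolding is_iso_def by blast

lemma iso_cancel_left:
  assumes f: "is_iso C Y Z f" and ob: "X \<in> Ob C" "Y \<in> Ob C" "Z \<in> Ob C"
    and g: "g \<in> Hom C X Y" and h: "h \<in> Hom C X Y"
    and eq: "Comp C X Y Z f g = Comp C X Y Z f h"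
  shows "g = h"
proof -
  obtain i where i: "f \<in> Hom C Y Z" "i \<in> Hom C Z Y" "Comp C Y Z Y i f = Ident C Y"
    using f by (rule is_isoE)
  have "g = Comp C X Z Y i (Comp C X Y Z f g)" using i ob g by (simp add: comp_assoc[symmetric])
  also have "\<dots> = h" unfolding eq using i ob h by (simp add: comp_assoc[symmetric])
  finally show ?thesis .
qed

lemma epi_cancel:
  "is_epi C X Y f \<Longrightarrow> Comp C X Y Z g f = Comp C X Y Z h f \<Longrightarrow> Z \<in> Ob C \<Longrightarrow>
    g \<in> Hom C Y Z \<Longrightarrow> h \<in> Hom C Y Z \<Longrightarrow> g = h"
  unfolding is_epi_def by blast

lemma mono_cancel:
  "is_mono C X Y f \<Longrightarrow> Comp C W X Y f g = Comp C W X Y f h \<Longrightarrow> W \<in> Ob C \<Longrightarrow>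
    g \<in> Hom C W X \<Longrightarrow> h \<in> Hom C W X \<Longrightarrow> g = h"
  unfolding is_mono_def by blast

lemma cokernelD:
  assumes "is_cokernel C X Y f Q q"
  shows "Q \<in> Ob C" "q \<in> Hom C Y Q" "Comp C X Y Q q f = zero_mor C X Q"
  using assms unfolding is_cokernel_def by auto

lemma cokernel_factor:
  assumes "is_cokernel C X Y f Q q" "T \<in> Ob C" "t \<in> Hom C Y T" "Comp C X Y T t f = zero_mor C X T"
  obtains u where "u \<in> Hom C Q T" "Comp C Y Q T u q = t"
  using assms unfolding is_cokernel_def by blast

lemma kernelD:
  assumes "is_kernel C X Y f K k"
  shows "K \<in> Ob C" "k \<in> Hom C K X" "Comp C K X Y f k = zero_mor C K Y"
  using assms unfolding is_kernel_def by auto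

lemma kernel_factor:
  assumes "is_kernel C X Y f K k" "T \<in> Ob C" "t \<in> Hom C T X" "Comp C T X Y f t = zero_mor C T Y"
  obtains u where "u \<in> Hom C T K" "Comp C T K X k u = t"
  using assms unfolding is_kernel_def by blast

lemma cokernel_is_epi:
  assumes q: "is_cokernel C X Y f Q q" and ob: "X \<in> Ob C" "Y \<in> Ob C" and f: "f \<in> Hom C X Y"
  shows "is_epi C Y Q q"
  unfolding is_epi_def
proof (intro conjI ballI impI)
  fix Z g h
  assume Z: "Z \<in> Ob C" and gh: "g \<in> Hom C Q Z" "h \<in> Hom C Q Z"
    and eq: "Comp C Y Q Z g q = Comp C Y Q Z h q"
  have "Comp C X Y Z (Comp C Y Q Z g q) f = zero_mor C X Z"
    using Z gh(1) cokernelD[OF q] ob f by (simp add: comp_assoc)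
  moreover have "Comp C Y Q Z g q \<in> Hom C Y Z" using Z gh(1) cokernelD[OF q] ob by simp
  ultimately have "\<exists>!u. u \<in> Hom C Q Z \<and> Comp C Y Q Z u q = Comp C Y Q Z g q"
    using q Z unfolding is_cokernel_def by blast
  thus "g = h" using eq gh by metis
qed (use cokernelD[OF q] in blast)

lemma kernel_is_mono:
  assumes k: "is_kernel C X Y f K k" and ob: "X \<in> Ob C" "Y \<in> Ob C" and f: "f \<in> Hom C X Y"
  shows "is_mono C K X k"
  unfolding is_mono_def
proof (intro conjI ballI impI)
  fix W g h
  assume W: "W \<in> Ob C" and gh: "g \<in> Hom C W K" "h \<in> Hom C W K"
    and eq: "Comp C W K X k g = Comp C W K X k h"
  have "Comp C W X Y f (Comp C W K X k g) = zero_mor C W Y"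
    using W gh(1) kernelD[OF k] ob f by (simp add: comp_assoc[symmetric])
  moreover have "Comp C W K X k g \<in> Hom C W X" using W gh(1) kernelD[OF k] ob by simp
  ultimately have "\<exists>!u. u \<in> Hom C W K \<and> Comp C W K X k u = Comp C W K X k g"
    using k W unfolding is_kernel_def by blast
  thus "g = h" using eq gh by metis
qed (use kernelD[OF k] in blast)

lemma is_cokernelI:
  assumes epi: "is_epi C Y Q q" and Q: "Q \<in> Ob C" and z: "Comp C X Y Q q f = zero_mor C X Q"
    and ex: "\<And>T t. T \<in> Ob C \<Longrightarrow> t \<in> Hom C Y T \<Longrightarrow> Comp C X Y T t f = zero_mor C X T \<Longrightarrow>
      \<exists>u \<in> Hom C Q T. Comp C Y Q T u q = t"
  shows "is_cokernel C X Y f Q q"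
  unfolding is_cokernel_def
proof (intro conjI ballI impI)
  fix T t assume T: "T \<in> Ob C" "t \<in> Hom C Y T" "Comp C X Y T t f = zero_mor C X T"
  obtain u where u: "u \<in> Hom C Q T" "Comp C Y Q T u q = t" using ex[OF T] by blast
  show "\<exists>!u. u \<in> Hom C Q T \<and> Comp C Y Q T u q = t"
    using u epi_cancel[OF epi _ T(1)] by blast
qed (use epi Q z in \<open>auto simp: is_epi_def\<close>)

lemma is_kernelI:
  assumes mono: "is_mono C K X k" and K: "K \<in> Ob C" and z: "Comp C K X Y f k = zero_mor C K Y"
    and ex: "\<And>T t. T \<in> Ob C \<Longrightarrow> t \<in> Hom C T X \<Longrightarrow> Comp C T X Y f t = zero_mor C T Y \<Longrightarrow>
      \<exists>u \<in> Hom C T K. Comp C T K X k u = t"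
  shows "is_kernel C X Y f K k"
  unfolding is_kernel_def
proof (intro conjI ballI impI)
  fix T t assume T: "T \<in> Ob C" "t \<in> Hom C T X" "Comp C T X Y f t = zero_mor C T Y"
  obtain u where u: "u \<in> Hom C T K" "Comp C T K X k u = t" using ex[OF T] by blast
  show "\<exists>!u. u \<in> Hom C T K \<and> Comp C T K X k u = t"
    using u mono_cancel[OF mono _ T(1)] by blast
qed (use mono K z in \<open>auto simp: is_mono_def\<close>)

text \<open>
  A morphism annihilates \<open>f \<circ> e\<close> exactly when it annihilates \<open>f\<close>, since \<open>e\<close> can be cancelled.
\<close>

lemma cokernel_precomp_epi:
  assumes q: "is_cokernel C X Y f Q q" and e: "is_epi C W X e"
    and ob: "W \<in> Ob C" "X \<in> Ob C" "Y \<in> Ob C" and f: "f \<in> Hom C X Y"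
  shows "is_cokernel C W Y (Comp C W X Y f e) Q q"
proof (rule is_cokernelI)
  note qD = cokernelD[OF q]
  have e': "e \<in> Hom C W X" using e by (simp add: is_epi_def)
  show "is_epi C Y Q q" using cokernel_is_epi[OF q ob(2,3) f] .
  show "Q \<in> Ob C" by (fact qD)
  show "Comp C W Y Q q (Comp C W X Y f e) = zero_mor C W Q"
    using qD ob f e' by (simp add: comp_assoc[symmetric])
  fix T t assume T: "T \<in> Ob C" "t \<in> Hom C Y T" "Comp C W Y T t (Comp C W X Y f e) = zero_mor C W T"
  have "Comp C W X T (Comp C X Y T t f) e = Comp C W X T (zero_mor C X T) e"
    using T ob f e' by (simp add: comp_assoc)
  hence "Comp C X Y T t f = zero_mor C X T"
    using epi_cancel[OF e _ T(1)] T ob f by simp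
  thus "\<exists>u \<in> Hom C Q T. Comp C Y Q T u q = t" using cokernel_factor[OF q T(1,2)] by blast
qed

end

context abelian_category
begin

text \<open>
  If \<open>e\<close> is the cokernel of \<open>g\<close>, then \<open>g\<close> factors through the kernel of \<open>e\<close>; hence whatever
  annihilates the kernel annihilates \<open>g\<close>.
\<close>

lemma epi_is_cokernel_of_kernel:
  assumes e: "is_epi C X Y e" and k: "is_kernel C X Y e K k" and ob: "X \<in> Ob C" "Y \<in> Ob C"
  shows "is_cokernel C K X k Y e"
proof (rule is_cokernelI[OF e ob(2) kernelD(3)[OF k]])
  have e': "e \<in> Hom C X Y" using e by (simp add: is_epi_def)
  obtain W g where W: "W \<in> Ob C" "g \<in> Hom C W X" and g: "is_cokernel C W X g Y e"
    using epi_is_cokernel[OF ob e] by blast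
  obtain w where w: "w \<in> Hom C W K" "Comp C W K X k w = g"
    using kernel_factor[OF k W cokernelD(3)[OF g]] .
  fix T t assume T: "T \<in> Ob C" "t \<in> Hom C X T" "Comp C K X T t k = zero_mor C K T"
  have "Comp C W X T t g = zero_mor C W T"
    unfolding w(2)[symmetric] using T W w(1) ob kernelD[OF k]
    by (simp add: comp_assoc[symmetric])
  thus "\<exists>u \<in> Hom C Y T. Comp C X Y T u e = t" using cokernel_factor[OF g T(1,2)] by blast
qed

lemma mono_is_kernel_of_cokernel:
  assumes m: "is_mono C X Y m" and q: "is_cokernel C X Y m Q q" and ob: "X \<in> Ob C" "Y \<in> Ob C"
  shows "is_kernel C Y Q q X m"
proof (rule is_kernelI[OF m ob(1) cokernelD(3)[OF q]])
  have m': "m \<in> Hom C X Y" using m by (simp add: is_mono_def)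
  obtain Z g where Z: "Z \<in> Ob C" "g \<in> Hom C Y Z" and g: "is_kernel C Y Z g X m"
    using mono_is_kernel[OF ob m] by blast
  obtain w where w: "w \<in> Hom C Q Z" "Comp C Y Q Z w q = g"
    using cokernel_factor[OF q Z kernelD(3)[OF g]] .
  fix T t assume T: "T \<in> Ob C" "t \<in> Hom C T Y" "Comp C T Y Q q t = zero_mor C T Q"
  have "Comp C T Y Z g t = zero_mor C T Z"
    unfolding w(2)[symmetric] using T Z w(1) ob cokernelD[OF q]
    by (simp add: comp_assoc)
  thus "\<exists>u \<in> Hom C T X. Comp C T X Y m u = t" using kernel_factor[OF g T(1,2)] by blast
qed

text \<open>
  Exactness says that \<open>g\<close> and the cokernel of \<open>f\<close> have the same kernel \<open>k\<close>. The epimorphism \<open>g\<close> is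
  the cokernel of \<open>k\<close>, and every morphism that annihilates \<open>f\<close> factors through the cokernel of \<open>f\<close>
  and therefore annihilates \<open>k\<close>.
\<close>

lemma exact_epi_is_cokernel:
  assumes ex: "exact_at C X Y Z f g" and g: "is_epi C Y Z g"
    and ob: "X \<in> Ob C" "Y \<in> Ob C" "Z \<in> Ob C"
  shows "is_cokernel C X Y f Z g"
proof -
  from ex obtain Q q K k where f: "f \<in> Hom C X Y" and q: "is_cokernel C X Y f Q q"
    and kq: "is_kernel C Y Q q K k" and kg: "is_kernel C Y Z g K k"
    unfolding exact_at_def by blast
  have gh: "g \<in> Hom C Y Z" using g by (simp add: is_epi_def)
  have gk: "is_cokernel C K Y k Z g" using epi_is_cokernel_of_kernel[OF g kg ob(2,3)] .
  note D = cokernelD[OF q] kernelD[OF kq] kernelD[OF kg]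
  obtain r where r: "r \<in> Hom C X K" "Comp C X K Y k r = f" using kernel_factor[OF kq ob(1) f D(3)] .
  show ?thesis
  proof (rule is_cokernelI[OF g ob(3)])
    show "Comp C X Y Z g f = zero_mor C X Z"
      unfolding r(2)[symmetric] using r(1) D gh ob by (simp add: comp_assoc[symmetric])
    fix T t assume T: "T \<in> Ob C" "t \<in> Hom C Y T" "Comp C X Y T t f = zero_mor C X T"
    obtain u where u: "u \<in> Hom C Q T" "Comp C Y Q T u q = t" using cokernel_factor[OF q T] .
    have "Comp C K Y T t k = zero_mor C K T"
      unfolding u(2)[symmetric] using u(1) D ob T by (simp add: comp_assoc)
    thus "\<exists>u \<in> Hom C Z T. Comp C Y Z T u g = t" using cokernel_factor[OF gk T(1,2)] by blast
  qed
qed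

lemma short_exact_kernel_epi:
  assumes e: "is_epi C X Y e" and k: "is_kernel C X Y e K k" and ob: "X \<in> Ob C" "Y \<in> Ob C"
  shows "short_exact C K X Y k e"
proof -
  have e': "e \<in> Hom C X Y" using e by (simp add: is_epi_def)
  show ?thesis unfolding short_exact_def exact_at_def
    using e e' k kernelD[OF k] kernel_is_mono[OF k ob e'] epi_is_cokernel_of_kernel[OF e k ob] by blast
qed

end

section \<open>Functors and adjunctions\<close>

context additive_functor
begin

lemmas [simp] = fob_in_Ob

lemma fmor_in_hom [simp]:
  "X \<in> Ob C \<Longrightarrow> Y \<in> Ob C \<Longrightarrow> f \<in> Hom C X Y \<Longrightarrow> fmor F X Y f \<in> Hom D (fob F X) (fob F Y)"
  using hom_in_carrier[OF fmor_hom] by simp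

lemma fmor_zero [simp]:
  assumes "X \<in> Ob C" "Y \<in> Ob C"
  shows "fmor F X Y (zero_mor C X Y) = zero_mor D (fob F X) (fob F Y)"
  by (rule hom_one[OF fmor_hom[OF assms]]) (simp_all add: assms source.hom_is_group target.hom_is_group)

lemma fmor_add:
  assumes "X \<in> Ob C" "Y \<in> Ob C" "f \<in> Hom C X Y" "g \<in> Hom C X Y"
  shows "fmor F X Y (add_mor C X Y f g) = add_mor D (fob F X) (fob F Y) (fmor F X Y f) (fmor F X Y g)"
  by (rule hom_mult[OF fmor_hom[OF assms(1,2)] assms(3,4)])

lemmas [simp] = fmor_ident

end

lemma additive_functor_comp:
  assumes "additive_functor C D F" "additive_functor D B G"
  shows "additive_functor C B (G \<circ>\<^sub>F F)"
proof -
  interpret F: additive_functor C D F by fact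
  interpret G: additive_functor D B G by fact
  show ?thesis
    by unfold_locales
      (auto simp: comp_functor_def F.fmor_add G.fmor_add F.fmor_comp G.fmor_comp intro!: homI)
qed

locale adjoint_pair = L: additive_functor C D L + R: additive_functor D C R
  for C :: "('o, 'm) cat" and D :: "('p, 'n) cat"
    and L :: "('o, 'm, 'p, 'n) functr" and R :: "('p, 'n, 'o, 'm) functr" +
  fixes \<eta> :: "'o \<Rightarrow> 'm" and \<epsilon> :: "'p \<Rightarrow> 'n"
  assumes adj: "adjunction C D L R \<eta> \<epsilon>"
begin

lemma unit_in_hom [simp]: "X \<in> Ob C \<Longrightarrow> \<eta> X \<in> Hom C X (fob R (fob L X))"
  using adj by (simp add: adjunction_def nat_trans_def comp_functor_def id_functor_def)

lemma counit_in_hom [simp]: "Y \<in> Ob D \<Longrightarrow> \<epsilon> Y \<in> Hom D (fob L (fob R Y)) Y"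
  using adj by (simp add: adjunction_def nat_trans_def comp_functor_def id_functor_def)

lemma unit_natural:
  "X \<in> Ob C \<Longrightarrow> Y \<in> Ob C \<Longrightarrow> f \<in> Hom C X Y \<Longrightarrow>
    Comp C X Y (fob R (fob L Y)) (\<eta> Y) f =
    Comp C X (fob R (fob L X)) (fob R (fob L Y)) (fmor R (fob L X) (fob L Y) (fmor L X Y f)) (\<eta> X)"
  using adj by (simp add: adjunction_def nat_trans_def comp_functor_def id_functor_def)

lemma counit_natural:
  "X \<in> Ob D \<Longrightarrow> Y \<in> Ob D \<Longrightarrow> f \<in> Hom D X Y \<Longrightarrow>
    Comp D (fob L (fob R X)) (fob L (fob R Y)) Y (\<epsilon> Y) (fmor L (fob R X) (fob R Y) (fmor R X Y f)) =
    Comp D (fob L (fob R X)) X Y f (\<epsilon> X)"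
  using adj by (simp add: adjunction_def nat_trans_def comp_functor_def id_functor_def)

lemma triangle_left [simp]:
  "X \<in> Ob C \<Longrightarrow> Comp D (fob L X) (fob L (fob R (fob L X))) (fob L X)
    (\<epsilon> (fob L X)) (fmor L X (fob R (fob L X)) (\<eta> X)) = Ident D (fob L X)"
  using adj by (simp add: adjunction_def)

lemma triangle_right [simp]:
  "Y \<in> Ob D \<Longrightarrow> Comp C (fob R Y) (fob R (fob L (fob R Y))) (fob R Y)
    (fmor R (fob L (fob R Y)) Y (\<epsilon> Y)) (\<eta> (fob R Y)) = Ident C (fob R Y)"
  using adj by (simp add: adjunction_def)

text \<open>
  The universal property of the counit. It is the form in which adjunctions are used below: only the
  counit and the left adjoint occur in it.
\<close>

lemma transpose:
  assumes X: "X \<in> Ob C" and Y: "Y \<in> Ob D" and g: "g \<in> Hom D (fob L X) Y"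
  shows "\<exists>!a. a \<in> Hom C X (fob R Y) \<and>
    Comp D (fob L X) (fob L (fob R Y)) Y (\<epsilon> Y) (fmor L X (fob R Y) a) = g"
proof (rule ex1I)
  let ?a = "Comp C X (fob R (fob L X)) (fob R Y) (fmor R (fob L X) Y g) (\<eta> X)"
  have "Comp D (fob L X) (fob L (fob R Y)) Y (\<epsilon> Y) (fmor L X (fob R Y) ?a) =
    Comp D (fob L X) (fob L (fob R (fob L X))) Y
      (Comp D (fob L (fob R (fob L X))) (fob L (fob R Y)) Y (\<epsilon> Y)
         (fmor L (fob R (fob L X)) (fob R Y) (fmor R (fob L X) Y g)))
      (fmor L X (fob R (fob L X)) (\<eta> X))"
    using X Y g by (simp add: L.fmor_comp L.target.comp_assoc)
  also have "\<dots> = g" using X Y g by (simp add: counit_natural L.target.comp_assoc)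
  finally show "?a \<in> Hom C X (fob R Y) \<and>
      Comp D (fob L X) (fob L (fob R Y)) Y (\<epsilon> Y) (fmor L X (fob R Y) ?a) = g"
    using X Y g by simp
  fix a assume a: "a \<in> Hom C X (fob R Y) \<and>
      Comp D (fob L X) (fob L (fob R Y)) Y (\<epsilon> Y) (fmor L X (fob R Y) a) = g"
  hence "?a = Comp C X (fob R (fob L (fob R Y))) (fob R Y) (fmor R (fob L (fob R Y)) Y (\<epsilon> Y))
      (Comp C X (fob R Y) (fob R (fob L (fob R Y))) (\<eta> (fob R Y)) a)"
    using X Y g by (auto simp: R.fmor_comp L.source.comp_assoc unit_natural)
  also have "\<dots> = a" using X Y a by (simp add: L.source.comp_assoc[symmetric])
  finally show "a = ?a" by simp
qed

lemma transpose_obtain: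
  assumes "X \<in> Ob C" "Y \<in> Ob D" "g \<in> Hom D (fob L X) Y"
  obtains a where "a \<in> Hom C X (fob R Y)"
    "Comp D (fob L X) (fob L (fob R Y)) Y (\<epsilon> Y) (fmor L X (fob R Y) a) = g"
  using transpose[OF assms] by blast

lemma transpose_inj:
  assumes "X \<in> Ob C" "Y \<in> Ob D" "a \<in> Hom C X (fob R Y)" "b \<in> Hom C X (fob R Y)"
    "Comp D (fob L X) (fob L (fob R Y)) Y (\<epsilon> Y) (fmor L X (fob R Y) a) =
     Comp D (fob L X) (fob L (fob R Y)) Y (\<epsilon> Y) (fmor L X (fob R Y) b)"
  shows "a = b"
  using transpose[of X Y "Comp D (fob L X) (fob L (fob R Y)) Y (\<epsilon> Y) (fmor L X (fob R Y) a)"] assms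
  by auto

text \<open>
  By a triangle identity \<open>R x\<close> is recovered from the composite of \<open>x\<close> with the counit.
\<close>

lemma counit_epi:
  assumes "faithful D R" and Y: "Y \<in> Ob D"
  shows "is_epi D (fob L (fob R Y)) Y (\<epsilon> Y)"
  unfolding is_epi_def
proof (intro conjI ballI impI)
  show "\<epsilon> Y \<in> Hom D (fob L (fob R Y)) Y" using Y by simp
  fix Z g h assume Z: "Z \<in> Ob D" and gh: "g \<in> Hom D Y Z" "h \<in> Hom D Y Z"
    and eq: "Comp D (fob L (fob R Y)) Y Z g (\<epsilon> Y) = Comp D (fob L (fob R Y)) Y Z h (\<epsilon> Y)"
  have "fmor R Y Z x = Comp C (fob R Y) (fob R (fob L (fob R Y))) (fob R Z)
      (fmor R (fob L (fob R Y)) Z (Comp D (fob L (fob R Y)) Y Z x (\<epsilon> Y))) (\<eta> (fob R Y))"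
    if "x \<in> Hom D Y Z" for x
    using that Y Z by (simp add: R.fmor_comp L.source.comp_assoc)
  hence "fmor R Y Z g = fmor R Y Z h" using gh eq by metis
  thus "g = h" using assms(1) Y Z gh unfolding faithful_def by (meson inj_onD)
qed

lemma unit_mono:
  assumes "faithful C L" and X: "X \<in> Ob C"
  shows "is_mono C X (fob R (fob L X)) (\<eta> X)"
  unfolding is_mono_def
proof (intro conjI ballI impI)
  show "\<eta> X \<in> Hom C X (fob R (fob L X))" using X by simp
  fix W g h assume W: "W \<in> Ob C" and gh: "g \<in> Hom C W X" "h \<in> Hom C W X"
    and eq: "Comp C W X (fob R (fob L X)) (\<eta> X) g = Comp C W X (fob R (fob L X)) (\<eta> X) h"
  have "fmor L W X x = Comp D (fob L W) (fob L (fob R (fob L X))) (fob L X) (\<epsilon> (fob L X))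
      (fmor L W (fob R (fob L X)) (Comp C W X (fob R (fob L X)) (\<eta> X) x))"
    if "x \<in> Hom C W X" for x
    using that X W by (simp add: L.fmor_comp L.target.comp_assoc[symmetric])
  hence "fmor L W X g = fmor L W X h" using gh eq by metis
  thus "g = h" using assms(1) X W gh unfolding faithful_def by (meson inj_onD)
qed

text \<open>
  Both parts of the universal property are transposed to the source category, where \<open>q\<close> has them.
\<close>

lemma left_adjoint_preserves_cokernel:
  assumes q: "is_cokernel C X Y f Q q" and ob: "X \<in> Ob C" "Y \<in> Ob C" and f: "f \<in> Hom C X Y"
  shows "is_cokernel D (fob L X) (fob L Y) (fmor L X Y f) (fob L Q) (fmor L Y Q q)"
proof (rule L.target.is_cokernelI)
  note qD = L.source.cokernelD[OF q]
  show "is_epi D (fob L Y) (fob L Q) (fmor L Y Q q)"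
    unfolding is_epi_def
  proof (intro conjI ballI impI)
    show "fmor L Y Q q \<in> Hom D (fob L Y) (fob L Q)" using ob qD by simp
    fix Z g h assume Z: "Z \<in> Ob D" and gh: "g \<in> Hom D (fob L Q) Z" "h \<in> Hom D (fob L Q) Z"
      and eq: "Comp D (fob L Y) (fob L Q) Z g (fmor L Y Q q) = Comp D (fob L Y) (fob L Q) Z h (fmor L Y Q q)"
    obtain a where a: "a \<in> Hom C Q (fob R Z)"
        "Comp D (fob L Q) (fob L (fob R Z)) Z (\<epsilon> Z) (fmor L Q (fob R Z) a) = g"
      using transpose_obtain[OF qD(1) Z gh(1)] .
    obtain b where b: "b \<in> Hom C Q (fob R Z)"
        "Comp D (fob L Q) (fob L (fob R Z)) Z (\<epsilon> Z) (fmor L Q (fob R Z) b) = h"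
      using transpose_obtain[OF qD(1) Z gh(2)] .
    have "Comp C Y Q (fob R Z) a q = Comp C Y Q (fob R Z) b q"
      by (rule transpose_inj[OF ob(2) Z])
        (use a b ob Z qD eq in \<open>auto simp: L.fmor_comp L.target.comp_assoc[symmetric]\<close>)
    hence "a = b"
      by (rule L.source.epi_cancel[OF L.source.cokernel_is_epi[OF q ob f]]) (use a(1) b(1) Z in simp_all)
    thus "g = h" using a b by simp
  qed
  show "fob L Q \<in> Ob D" using qD by simp
  show "Comp D (fob L X) (fob L Y) (fob L Q) (fmor L Y Q q) (fmor L X Y f) = zero_mor D (fob L X) (fob L Q)"
    using qD ob f by (simp add: L.fmor_comp[symmetric])
  fix T t assume T: "T \<in> Ob D" and t: "t \<in> Hom D (fob L Y) T"
    and z: "Comp D (fob L X) (fob L Y) T t (fmor L X Y f) = zero_mor D (fob L X) T"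
  obtain a where a: "a \<in> Hom C Y (fob R T)"
      "Comp D (fob L Y) (fob L (fob R T)) T (\<epsilon> T) (fmor L Y (fob R T) a) = t"
    using transpose_obtain[OF ob(2) T t] .
  have af: "Comp C X Y (fob R T) a f = zero_mor C X (fob R T)"
    by (rule transpose_inj[OF ob(1) T])
      (use a ob T f z in \<open>auto simp: L.fmor_comp L.target.comp_assoc[symmetric]\<close>)
  obtain u where u: "u \<in> Hom C Q (fob R T)" "Comp C Y Q (fob R T) u q = a"
    using L.source.cokernel_factor[OF q R.fob_in_Ob[OF T] a(1) af] .
  have "Comp D (fob L Y) (fob L Q) T
      (Comp D (fob L Q) (fob L (fob R T)) T (\<epsilon> T) (fmor L Q (fob R T) u)) (fmor L Y Q q) = t"
    using a u T ob qD by (simp add: L.fmor_comp[symmetric] L.target.comp_assoc)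
  thus "\<exists>u \<in> Hom D (fob L Q) T. Comp D (fob L Y) (fob L Q) T u (fmor L Y Q q) = t"
    by (rule bexI) (use u qD T in simp)
qed

text \<open>
  The transpose of \<open>L: Hom(W, Z) \<rightarrow> Hom(L W, L Z)\<close> is composition with the unit at \<open>Z\<close>, so that bijectivity
  for all \<open>W\<close> is invertibility of the unit. Concretely, the inverse is the morphism \<open>w\<close> that \<open>L\<close> sends to
  the counit at \<open>L Z\<close>.
\<close>

lemma unit_is_iso:
  assumes Z: "Z \<in> Ob C"
    and bij: "\<And>W. W \<in> Ob C \<Longrightarrow> bij_betw (fmor L W Z) (Hom C W Z) (Hom D (fob L W) (fob L Z))"
  shows "is_iso C Z (fob R (fob L Z)) (\<eta> Z)"
proof -
  let ?RL = "fob R (fob L Z)"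
  have "\<epsilon> (fob L Z) \<in> fmor L ?RL Z ` Hom C ?RL Z" using bij[of ?RL] Z by (simp add: bij_betw_def)
  then obtain w where w: "w \<in> Hom C ?RL Z" "fmor L ?RL Z w = \<epsilon> (fob L Z)" by auto
  have "inj_on (fmor L Z Z) (Hom C Z Z)" using bij[OF Z] by (rule bij_betw_imp_inj_on)
  moreover have "fmor L Z Z (Comp C Z ?RL Z w (\<eta> Z)) = fmor L Z Z (Ident C Z)"
    using Z w by (simp add: L.fmor_comp)
  ultimately have 1: "Comp C Z ?RL Z w (\<eta> Z) = Ident C Z"
    by (rule inj_onD) (use Z w in auto)
  have "Comp C ?RL Z ?RL (\<eta> Z) w = Ident C ?RL" using Z w by (simp add: unit_natural)
  with 1 show ?thesis unfolding is_iso_def using Z w(1) by (intro conjI bexI[where x = w]) simp_all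
qed

end

lemma adjunction_imp_adjoint_pair:
  assumes "adjunction C D L R \<eta> \<epsilon>" shows "adjoint_pair C D L R \<eta> \<epsilon>"
proof -
  interpret L: additive_functor C D L using assms by (simp add: adjunction_def)
  interpret R: additive_functor D C R using assms by (simp add: adjunction_def)
  show ?thesis by unfold_locales fact
qed


text \<open>
  The unit is the transpose of the identity. Naturality and the remaining triangle identity hold because
  both sides have the same transpose.
\<close>

lemma adjunction_of_universal_counit:
  assumes L: "additive_functor C D L" and R: "additive_functor D C R"
    and nat: "nat_trans D D (L \<circ>\<^sub>F R) id_functor \<epsilon>"
    and univ: "\<And>X Y g. X \<in> Ob C \<Longrightarrow> Y \<in> Ob D \<Longrightarrow> g \<in> Hom D (fob L X) Y \<Longrightarrow>
      \<exists>!a. a \<in> Hom C X (fob R Y) \<and>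
        Comp D (fob L X) (fob L (fob R Y)) Y (\<epsilon> Y) (fmor L X (fob R Y) a) = g"
  shows "\<exists>\<eta>. adjunction C D L R \<eta> \<epsilon>"
proof -
  interpret L: additive_functor C D L by fact
  interpret R: additive_functor D C R by fact
  have \<epsilon>: "\<epsilon> Y \<in> Hom D (fob L (fob R Y)) Y" if "Y \<in> Ob D" for Y
    using nat that by (simp add: nat_trans_def comp_functor_def id_functor_def)
  have \<epsilon>_nat: "Comp D (fob L (fob R X)) (fob L (fob R Y)) Y (\<epsilon> Y) (fmor L (fob R X) (fob R Y) (fmor R X Y f)) =
      Comp D (fob L (fob R X)) X Y f (\<epsilon> X)" if "X \<in> Ob D" "Y \<in> Ob D" "f \<in> Hom D X Y" for X Y f
    using nat that by (simp add: nat_trans_def comp_functor_def id_functor_def)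
  have inj: "a = b" if "X \<in> Ob C" "Y \<in> Ob D" "a \<in> Hom C X (fob R Y)" "b \<in> Hom C X (fob R Y)"
    "Comp D (fob L X) (fob L (fob R Y)) Y (\<epsilon> Y) (fmor L X (fob R Y) a) =
     Comp D (fob L X) (fob L (fob R Y)) Y (\<epsilon> Y) (fmor L X (fob R Y) b)" for X Y a b
    using univ[of X Y "Comp D (fob L X) (fob L (fob R Y)) Y (\<epsilon> Y) (fmor L X (fob R Y) a)"] that \<epsilon>
    by auto
  have "\<forall>X. \<exists>a. X \<in> Ob C \<longrightarrow> a \<in> Hom C X (fob R (fob L X)) \<and>
      Comp D (fob L X) (fob L (fob R (fob L X))) (fob L X) (\<epsilon> (fob L X))
        (fmor L X (fob R (fob L X)) a) = Ident D (fob L X)"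
    using univ by (metis L.fob_in_Ob L.target.ident_in_hom)
  then obtain \<eta> where \<eta>: "\<And>X. X \<in> Ob C \<Longrightarrow> \<eta> X \<in> Hom C X (fob R (fob L X))"
    and tri: "\<And>X. X \<in> Ob C \<Longrightarrow> Comp D (fob L X) (fob L (fob R (fob L X))) (fob L X) (\<epsilon> (fob L X))
        (fmor L X (fob R (fob L X)) (\<eta> X)) = Ident D (fob L X)"
    by metis
  have \<eta>_nat: "Comp C X Y (fob R (fob L Y)) (\<eta> Y) f =
      Comp C X (fob R (fob L X)) (fob R (fob L Y)) (fmor R (fob L X) (fob L Y) (fmor L X Y f)) (\<eta> X)"
    if X: "X \<in> Ob C" and Y: "Y \<in> Ob C" and f: "f \<in> Hom C X Y" for X Y f
  proof (rule inj[of X "fob L Y"])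
    have "Comp D (fob L X) (fob L (fob R (fob L Y))) (fob L Y) (\<epsilon> (fob L Y))
        (fmor L X (fob R (fob L Y)) (Comp C X Y (fob R (fob L Y)) (\<eta> Y) f)) = fmor L X Y f"
      using X Y f \<eta> \<epsilon> tri by (simp add: L.fmor_comp L.target.comp_assoc[symmetric])
    moreover have "Comp D (fob L X) (fob L (fob R (fob L Y))) (fob L Y) (\<epsilon> (fob L Y))
        (fmor L X (fob R (fob L Y)) (Comp C X (fob R (fob L X)) (fob R (fob L Y))
          (fmor R (fob L X) (fob L Y) (fmor L X Y f)) (\<eta> X))) =
        Comp D (fob L X) (fob L (fob R (fob L X))) (fob L Y)
          (Comp D (fob L (fob R (fob L X))) (fob L X) (fob L Y) (fmor L X Y f) (\<epsilon> (fob L X)))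
          (fmor L X (fob R (fob L X)) (\<eta> X))"
      using X Y f \<eta> \<epsilon> by (simp add: L.fmor_comp L.target.comp_assoc[symmetric] \<epsilon>_nat)
    moreover have "\<dots> = fmor L X Y f" using X Y f \<eta> \<epsilon> tri by (simp add: L.target.comp_assoc)
    ultimately show "Comp D (fob L X) (fob L (fob R (fob L Y))) (fob L Y) (\<epsilon> (fob L Y))
        (fmor L X (fob R (fob L Y)) (Comp C X Y (fob R (fob L Y)) (\<eta> Y) f)) =
      Comp D (fob L X) (fob L (fob R (fob L Y))) (fob L Y) (\<epsilon> (fob L Y))
        (fmor L X (fob R (fob L Y)) (Comp C X (fob R (fob L X)) (fob R (fob L Y))
          (fmor R (fob L X) (fob L Y) (fmor L X Y f)) (\<eta> X)))" by simp
  qed (use X Y f \<eta> in auto)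
  have tri': "Comp C (fob R Y) (fob R (fob L (fob R Y))) (fob R Y)
      (fmor R (fob L (fob R Y)) Y (\<epsilon> Y)) (\<eta> (fob R Y)) = Ident C (fob R Y)"
    if Y: "Y \<in> Ob D" for Y
  proof (rule inj[of "fob R Y" Y])
    have "Comp D (fob L (fob R Y)) (fob L (fob R Y)) Y (\<epsilon> Y) (fmor L (fob R Y) (fob R Y)
        (Comp C (fob R Y) (fob R (fob L (fob R Y))) (fob R Y)
          (fmor R (fob L (fob R Y)) Y (\<epsilon> Y)) (\<eta> (fob R Y)))) =
      Comp D (fob L (fob R Y)) (fob L (fob R (fob L (fob R Y)))) Y
        (Comp D (fob L (fob R (fob L (fob R Y)))) (fob L (fob R Y)) Y (\<epsilon> Y) (\<epsilon> (fob L (fob R Y))))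
        (fmor L (fob R Y) (fob R (fob L (fob R Y))) (\<eta> (fob R Y)))"
      using Y \<eta> \<epsilon> by (simp add: L.fmor_comp L.target.comp_assoc[symmetric] \<epsilon>_nat)
    also have "\<dots> = \<epsilon> Y" using Y \<eta> \<epsilon> tri by (simp add: L.target.comp_assoc)
    finally show "Comp D (fob L (fob R Y)) (fob L (fob R Y)) Y (\<epsilon> Y) (fmor L (fob R Y) (fob R Y)
        (Comp C (fob R Y) (fob R (fob L (fob R Y))) (fob R Y)
          (fmor R (fob L (fob R Y)) Y (\<epsilon> Y)) (\<eta> (fob R Y)))) =
      Comp D (fob L (fob R Y)) (fob L (fob R Y)) Y (\<epsilon> Y) (fmor L (fob R Y) (fob R Y) (Ident C (fob R Y)))"
      using Y \<epsilon> by simp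
  qed (use Y \<eta> \<epsilon> in auto)
  have "nat_trans C C id_functor (R \<circ>\<^sub>F L) \<eta>"
    using \<eta> \<eta>_nat by (simp add: nat_trans_def comp_functor_def id_functor_def)
  thus ?thesis unfolding adjunction_def using L R nat tri tri' by blast
qed

text \<open>
  The choice of a universal arrow for every object determines the right adjoint on morphisms: its value
  at \<open>g\<close> is the transpose of \<open>g \<circ> \<epsilon>\<close>, and uniqueness of transposes makes it an additive functor.
\<close>

lemma adjunction_of_universal_arrows:
  assumes L: "additive_functor C D L"
    and r: "\<And>Y. Y \<in> Ob D \<Longrightarrow> r Y \<in> Ob C"
    and \<epsilon>: "\<And>Y. Y \<in> Ob D \<Longrightarrow> \<epsilon> Y \<in> Hom D (fob L (r Y)) Y"
    and univ: "\<And>X Y g. X \<in> Ob C \<Longrightarrow> Y \<in> Ob D \<Longrightarrow> g \<in> Hom D (fob L X) Y \<Longrightarrow>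
      \<exists>!a. a \<in> Hom C X (r Y) \<and> Comp D (fob L X) (fob L (r Y)) Y (\<epsilon> Y) (fmor L X (r Y) a) = g"
  shows "\<exists>R \<eta>. adjunction C D L R \<eta> \<epsilon>"
proof -
  interpret L: additive_functor C D L by fact
  \<comment> \<open>\<open>\<Phi> X Y a\<close> is the morphism \<open>L X \<rightarrow> Y\<close> whose transpose is \<open>a\<close>\<close>
  define \<Phi> where "\<Phi> X Y a = Comp D (fob L X) (fob L (r Y)) Y (\<epsilon> Y) (fmor L X (r Y) a)" for X Y a
  have inj: "a = b" if "\<Phi> X Y a = \<Phi> X Y b" "X \<in> Ob C" "Y \<in> Ob D" "a \<in> Hom C X (r Y)" "b \<in> Hom C X (r Y)" for X Y a b
    using univ[of X Y "\<Phi> X Y a"] that \<epsilon> r unfolding \<Phi>_def by auto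
  have pre: "Comp D (fob L X) (fob L Z) Y (\<Phi> Z Y a) (fmor L X Z f) = \<Phi> X Y (Comp C X Z (r Y) a f)"
    if "X \<in> Ob C" "Y \<in> Ob D" "Z \<in> Ob C" "a \<in> Hom C Z (r Y)" "f \<in> Hom C X Z" for X Y Z a f
    unfolding \<Phi>_def using that r \<epsilon> by (simp add: L.fmor_comp L.target.comp_assoc)
  have "\<exists>a. a \<in> Hom C (r X) (r Y) \<and> \<Phi> (r X) Y a = Comp D (fob L (r X)) X Y g (\<epsilon> X)"
    if "X \<in> Ob D" "Y \<in> Ob D" "g \<in> Hom D X Y" for X Y g
    using univ[of "r X" Y "Comp D (fob L (r X)) X Y g (\<epsilon> X)"] that r \<epsilon> unfolding \<Phi>_def by auto
  then obtain \<rho> where \<rho>: "\<And>X Y g. X \<in> Ob D \<Longrightarrow> Y \<in> Ob D \<Longrightarrow> g \<in> Hom D X Y \<Longrightarrow> \<rho> X Y g \<in> Hom C (r X) (r Y)"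
    and \<rho>_eq: "\<And>X Y g. X \<in> Ob D \<Longrightarrow> Y \<in> Ob D \<Longrightarrow> g \<in> Hom D X Y \<Longrightarrow>
        \<Phi> (r X) Y (\<rho> X Y g) = Comp D (fob L (r X)) X Y g (\<epsilon> X)"
    by metis
  define R where "R = \<lparr>fob = r, fmor = \<rho>\<rparr>"
  have R: "additive_functor D C R"
  proof (unfold_locales, unfold R_def functr.simps)
    fix X assume X: "X \<in> Ob D"
    show "r X \<in> Ob C" using X r by simp
    show "\<rho> X X (Ident D X) = Ident C (r X)"
      by (rule inj[of "r X" X]) (use X r \<rho> \<rho>_eq \<epsilon> in \<open>auto simp: \<Phi>_def\<close>)
  next
    fix X Y assume XY: "X \<in> Ob D" "Y \<in> Ob D"
    show "\<rho> X Y \<in> hom (HomG D X Y) (HomG C (r X) (r Y))"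
    proof (rule homI)
      fix f g assume fg: "f \<in> Hom D X Y" "g \<in> Hom D X Y"
      show "\<rho> X Y f \<in> Hom C (r X) (r Y)" using XY fg \<rho> by simp
      have "\<Phi> (r X) Y (add_mor C (r X) (r Y) (\<rho> X Y f) (\<rho> X Y g)) =
          add_mor D (fob L (r X)) Y (\<Phi> (r X) Y (\<rho> X Y f)) (\<Phi> (r X) Y (\<rho> X Y g))"
        unfolding \<Phi>_def using XY fg r \<rho> \<epsilon> by (simp add: L.fmor_add L.target.comp_distrib_left)
      also have "\<dots> = \<Phi> (r X) Y (\<rho> X Y (add_mor D X Y f g))"
        using XY fg r \<rho>_eq \<epsilon> by (simp add: L.target.comp_distrib_right)
      finally show "\<rho> X Y (add_mor D X Y f g) = add_mor C (r X) (r Y) (\<rho> X Y f) (\<rho> X Y g)"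
        using inj[of "r X" Y] XY fg r \<rho> by simp
    qed
    fix Z g f assume Z: "Z \<in> Ob D" and gf: "g \<in> Hom D Y Z" "f \<in> Hom D X Y"
    have "\<Phi> (r X) Z (Comp C (r X) (r Y) (r Z) (\<rho> Y Z g) (\<rho> X Y f)) =
        Comp D (fob L (r X)) (fob L (r Y)) Z (Comp D (fob L (r Y)) Y Z g (\<epsilon> Y)) (fmor L (r X) (r Y) (\<rho> X Y f))"
      using XY Z gf r \<rho> by (simp add: pre[symmetric] \<rho>_eq)
    also have "\<dots> = Comp D (fob L (r X)) Y Z g (\<Phi> (r X) Y (\<rho> X Y f))"
      unfolding \<Phi>_def using XY Z gf r \<rho> \<epsilon> by (simp add: L.target.comp_assoc)
    also have "\<dots> = \<Phi> (r X) Z (\<rho> X Z (Comp D X Y Z g f))"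
      using XY Z gf r \<rho>_eq \<epsilon> by (simp add: L.target.comp_assoc)
    finally show "\<rho> X Z (Comp D X Y Z g f) = Comp C (r X) (r Y) (r Z) (\<rho> Y Z g) (\<rho> X Y f)"
      using inj[of "r X" Z] XY Z gf r \<rho> by simp
  qed
  have "nat_trans D D (L \<circ>\<^sub>F R) id_functor \<epsilon>"
    using \<epsilon> \<rho>_eq by (simp add: nat_trans_def comp_functor_def id_functor_def R_def \<Phi>_def)
  hence "\<exists>\<eta>. adjunction C D L R \<eta> \<epsilon>"
    by (rule adjunction_of_universal_counit[OF L R]) (use univ in \<open>simp add: R_def\<close>)
  thus ?thesis by blast
qed

lemma (in adjoint_pair) right_adjoint_iso_invariant:
  assumes G: "additive_functor D C G" and \<iota>: "nat_iso D C G R \<iota>"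
  shows "\<exists>\<eta>' \<epsilon>'. adjunction C D L G \<eta>' \<epsilon>'"
proof -
  interpret G: additive_functor D C G by fact
  have \<iota>_hom [simp]: "\<iota> Y \<in> Hom C (fob G Y) (fob R Y)" and \<iota>_iso: "is_iso C (fob G Y) (fob R Y) (\<iota> Y)"
    if "Y \<in> Ob D" for Y using \<iota> that by (auto simp: nat_iso_def nat_trans_def)
  have \<iota>_nat: "Comp C (fob G X) (fob G Y) (fob R Y) (\<iota> Y) (fmor G X Y f) =
      Comp C (fob G X) (fob R X) (fob R Y) (fmor R X Y f) (\<iota> X)"
    if "X \<in> Ob D" "Y \<in> Ob D" "f \<in> Hom D X Y" for X Y f
    using \<iota> that by (auto simp: nat_iso_def nat_trans_def)
  define \<epsilon>' where "\<epsilon>' Y = Comp D (fob L (fob G Y)) (fob L (fob R Y)) Y (\<epsilon> Y) (fmor L (fob G Y) (fob R Y) (\<iota> Y))" for Y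
  have \<epsilon>'_L: "Comp D (fob L X) (fob L (fob G Y)) Y (\<epsilon>' Y) (fmor L X (fob G Y) a) =
      Comp D (fob L X) (fob L (fob R Y)) Y (\<epsilon> Y) (fmor L X (fob R Y) (Comp C X (fob G Y) (fob R Y) (\<iota> Y) a))"
    if "X \<in> Ob C" "Y \<in> Ob D" "a \<in> Hom C X (fob G Y)" for X Y a
    unfolding \<epsilon>'_def using that by (simp add: L.fmor_comp L.target.comp_assoc)
  have "\<exists>\<eta>'. adjunction C D L G \<eta>' \<epsilon>'"
  proof (rule adjunction_of_universal_counit[OF L.additive_functor_axioms G])
    show "nat_trans D D (L \<circ>\<^sub>F G) id_functor \<epsilon>'"
      unfolding nat_trans_def comp_functor_def id_functor_def functr.simps
    proof (intro conjI ballI)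
      fix X assume X: "X \<in> Ob D"
      show "\<epsilon>' X \<in> Hom D (fob L (fob G X)) X" using X by (simp add: \<epsilon>'_def)
      fix Y f assume Y: "Y \<in> Ob D" and f: "f \<in> Hom D X Y"
      have "Comp D (fob L (fob G X)) (fob L (fob G Y)) Y (\<epsilon>' Y) (fmor L (fob G X) (fob G Y) (fmor G X Y f)) =
        Comp D (fob L (fob G X)) (fob L (fob R X)) Y
          (Comp D (fob L (fob R X)) (fob L (fob R Y)) Y (\<epsilon> Y) (fmor L (fob R X) (fob R Y) (fmor R X Y f)))
          (fmor L (fob G X) (fob R X) (\<iota> X))"
        using X Y f by (simp add: \<epsilon>'_L \<iota>_nat L.fmor_comp L.target.comp_assoc)
      also have "\<dots> = Comp D (fob L (fob G X)) X Y f (\<epsilon>' X)"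
        unfolding \<epsilon>'_def using X Y f by (simp add: counit_natural L.target.comp_assoc)
      finally show "Comp D (fob L (fob G X)) (fob L (fob G Y)) Y (\<epsilon>' Y) (fmor L (fob G X) (fob G Y) (fmor G X Y f)) =
        Comp D (fob L (fob G X)) X Y f (\<epsilon>' X)" .
    qed
    fix X Y g assume X: "X \<in> Ob C" and Y: "Y \<in> Ob D" and g: "g \<in> Hom D (fob L X) Y"
    obtain i where i: "i \<in> Hom C (fob R Y) (fob G Y)"
        "Comp C (fob G Y) (fob R Y) (fob G Y) i (\<iota> Y) = Ident C (fob G Y)"
        "Comp C (fob R Y) (fob G Y) (fob R Y) (\<iota> Y) i = Ident C (fob R Y)"
      using \<iota>_iso[OF Y] by (rule L.source.is_isoE)
    obtain b where b: "b \<in> Hom C X (fob R Y)"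
        "Comp D (fob L X) (fob L (fob R Y)) Y (\<epsilon> Y) (fmor L X (fob R Y) b) = g"
      using transpose_obtain[OF X Y g] .
    show "\<exists>!a. a \<in> Hom C X (fob G Y) \<and>
        Comp D (fob L X) (fob L (fob G Y)) Y (\<epsilon>' Y) (fmor L X (fob G Y) a) = g"
    proof (rule ex1I)
      let ?a = "Comp C X (fob R Y) (fob G Y) i b"
      have "Comp C X (fob G Y) (fob R Y) (\<iota> Y) ?a = b"
        using X Y i b by (simp add: L.source.comp_assoc[symmetric])
      thus "?a \<in> Hom C X (fob G Y) \<and>
          Comp D (fob L X) (fob L (fob G Y)) Y (\<epsilon>' Y) (fmor L X (fob G Y) ?a) = g"
        using X Y i b by (simp add: \<epsilon>'_L)
      fix a assume a: "a \<in> Hom C X (fob G Y) \<and>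
          Comp D (fob L X) (fob L (fob G Y)) Y (\<epsilon>' Y) (fmor L X (fob G Y) a) = g"
      have "Comp C X (fob G Y) (fob R Y) (\<iota> Y) a = b"
        by (rule transpose_inj[OF X Y]) (use a b X Y in \<open>auto simp: \<epsilon>'_L\<close>)
      thus "a = ?a" using X Y i a by (auto simp: L.source.comp_assoc[symmetric])
    qed
  qed
  thus ?thesis by blast
qed

section \<open>The induced functor\<close>

text \<open>
  The hypothesis \<open>E \<circ> f_sh = f_st\<close> forces \<open>E\<close> to be the identity on objects, so that \<open>fmor E X Y\<close> maps
  morphisms \<open>f_sh X \<rightarrow> f_sh Y\<close> to morphisms \<open>f_st X \<rightarrow> f_st Y\<close>.
\<close>

locale nakayama_setting = abelian_category A
    + sh: adjoint_pair D A f_sh f_up \<eta>\<^sub>1 \<epsilon>\<^sub>1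
    + st: adjoint_pair A D f_up f_st \<eta>\<^sub>2 \<epsilon>\<^sub>2
  for A :: "('a, 'm) cat" and D :: "('d, 'n) cat"
    and f_sh :: "('d, 'n, 'a, 'm) functr"
    and f_up :: "('a, 'm, 'd, 'n) functr"
    and f_st :: "('d, 'n, 'a, 'm) functr"
    and \<eta>\<^sub>1 :: "'d \<Rightarrow> 'n" and \<epsilon>\<^sub>1 :: "'a \<Rightarrow> 'm"
    and \<eta>\<^sub>2 :: "'a \<Rightarrow> 'm" and \<epsilon>\<^sub>2 :: "'d \<Rightarrow> 'n" +
  fixes E :: "('d, 'm, 'd, 'm) functr"
  assumes faithful_up: "faithful A f_up"
    and E_category_iso: "category_iso (im_category D A f_sh) (im_category D A f_st) E"
    and E_sh: "functor_eq D (E \<circ>\<^sub>F to_im f_sh) (to_im f_st)"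
begin

abbreviation P :: "'a \<Rightarrow> 'a" where "P X \<equiv> fob f_sh (fob f_up X)"
abbreviation Q :: "'a \<Rightarrow> 'a" where "Q X \<equiv> fob f_st (fob f_up X)"

subsection \<open>The isomorphism E on morphisms\<close>

lemma fob_E: "X \<in> Ob D \<Longrightarrow> fob E X = X"
  using E_sh by (simp add: functor_eq_def comp_functor_def to_im_def)

lemma E_shriek:
  "X \<in> Ob D \<Longrightarrow> Y \<in> Ob D \<Longrightarrow> d \<in> Hom D X Y \<Longrightarrow> fmor E X Y (fmor f_sh X Y d) = fmor f_st X Y d"
  using E_sh by (simp add: functor_eq_def comp_functor_def to_im_def)

lemma E_functor: "additive_functor (im_category D A f_sh) (im_category D A f_st) E"
  using E_category_iso by (simp add: category_iso_def)

lemma E_hom [simp]: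
  assumes "X \<in> Ob D" "Y \<in> Ob D" "g \<in> Hom A (fob f_sh X) (fob f_sh Y)"
  shows "fmor E X Y g \<in> Hom A (fob f_st X) (fob f_st Y)"
  using additive_functor.fmor_in_hom[OF E_functor, of X Y g] assms
  by (simp add: im_category_def fob_E)

lemma E_zero [simp]:
  assumes "X \<in> Ob D" "Y \<in> Ob D"
  shows "fmor E X Y (zero_mor A (fob f_sh X) (fob f_sh Y)) = zero_mor A (fob f_st X) (fob f_st Y)"
  using additive_functor.fmor_zero[OF E_functor, of X Y] assms
  by (simp add: im_category_def fob_E)

lemma E_add:
  assumes "X \<in> Ob D" "Y \<in> Ob D" "g \<in> Hom A (fob f_sh X) (fob f_sh Y)" "h \<in> Hom A (fob f_sh X) (fob f_sh Y)"
  shows "fmor E X Y (add_mor A (fob f_sh X) (fob f_sh Y) g h) =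
    add_mor A (fob f_st X) (fob f_st Y) (fmor E X Y g) (fmor E X Y h)"
  using additive_functor.fmor_add[OF E_functor, of X Y g h] assms
  by (simp add: im_category_def fob_E)

lemma E_ident [simp]:
  assumes "X \<in> Ob D" shows "fmor E X X (Ident A (fob f_sh X)) = Ident A (fob f_st X)"
  using additive_functor.fmor_ident[OF E_functor, of X] assms
  by (simp add: im_category_def fob_E)

lemma E_comp:
  assumes "X \<in> Ob D" "Y \<in> Ob D" "Z \<in> Ob D"
    "g \<in> Hom A (fob f_sh Y) (fob f_sh Z)" "f \<in> Hom A (fob f_sh X) (fob f_sh Y)"
  shows "fmor E X Z (Comp A (fob f_sh X) (fob f_sh Y) (fob f_sh Z) g f) =
    Comp A (fob f_st X) (fob f_st Y) (fob f_st Z) (fmor E Y Z g) (fmor E X Y f)"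
  using additive_functor.fmor_comp[OF E_functor, of X Y Z g f] assms
  by (simp add: im_category_def fob_E)

lemma E_bij:
  assumes XY: "X \<in> Ob D" "Y \<in> Ob D"
  shows "bij_betw (fmor E X Y) (Hom A (fob f_sh X) (fob f_sh Y)) (Hom A (fob f_st X) (fob f_st Y))"
proof -
  obtain G where G: "additive_functor (im_category D A f_st) (im_category D A f_sh) G"
    and GE: "functor_eq (im_category D A f_sh) (G \<circ>\<^sub>F E) id_functor"
    and EG: "functor_eq (im_category D A f_st) (E \<circ>\<^sub>F G) id_functor"
    using E_category_iso unfolding category_iso_def by (elim conjE exE)
  have fob_G: "fob G Z = Z" if "Z \<in> Ob D" for Z
    using GE that by (simp add: functor_eq_def comp_functor_def id_functor_def im_category_def fob_E)
  show ?thesis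
  proof (rule bij_betw_byWitness[where f' = "fmor G X Y"])
    show "\<forall>a\<in>Hom A (fob f_sh X) (fob f_sh Y). fmor G X Y (fmor E X Y a) = a"
      using GE XY by (simp add: functor_eq_def comp_functor_def id_functor_def im_category_def fob_E)
    show "\<forall>a\<in>Hom A (fob f_st X) (fob f_st Y). fmor E X Y (fmor G X Y a) = a"
      using EG XY by (simp add: functor_eq_def comp_functor_def id_functor_def im_category_def fob_G)
    show "fmor E X Y ` Hom A (fob f_sh X) (fob f_sh Y) \<subseteq> Hom A (fob f_st X) (fob f_st Y)"
      using XY by (intro image_subsetI) simp
    show "fmor G X Y ` Hom A (fob f_st X) (fob f_st Y) \<subseteq> Hom A (fob f_sh X) (fob f_sh Y)"
    proof (rule image_subsetI)
      fix h assume "h \<in> Hom A (fob f_st X) (fob f_st Y)"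
      thus "fmor G X Y h \<in> Hom A (fob f_sh X) (fob f_sh Y)"
        using additive_functor.fmor_in_hom[OF G, of X Y h] XY by (simp add: im_category_def fob_G)
    qed
  qed
qed

lemma E_inj:
  assumes "fmor E X Y g = fmor E X Y h" "X \<in> Ob D" "Y \<in> Ob D"
    "g \<in> Hom A (fob f_sh X) (fob f_sh Y)" "h \<in> Hom A (fob f_sh X) (fob f_sh Y)"
  shows "g = h"
  using bij_betw_imp_inj_on[OF E_bij[OF assms(2,3)]] assms(1,4,5) by (rule inj_onD)

lemma E_surj:
  assumes "X \<in> Ob D" "Y \<in> Ob D" "h \<in> Hom A (fob f_st X) (fob f_st Y)"
  obtains g where "g \<in> Hom A (fob f_sh X) (fob f_sh Y)" "fmor E X Y g = h"
proof -
  have "h \<in> fmor E X Y ` Hom A (fob f_sh X) (fob f_sh Y)"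
    using bij_betw_imp_surj_on[OF E_bij[OF assms(1,2)]] assms(3) by simp
  thus ?thesis using that by (elim imageE) simp
qed

subsection \<open>Presentations by objects in the image of the left adjoint\<close>

text \<open>
  The kernel of the counit \<open>P X \<rightarrow> X\<close> together with its inclusion: a syzygy of \<open>X\<close> for the cover \<open>P X\<close>.
\<close>

definition syz :: "'a \<Rightarrow> 'a \<times> 'm" where
  "syz X = (SOME (K, k). is_kernel A (P X) X (\<epsilon>\<^sub>1 X) K k)"

lemma syz_kernel: "X \<in> Ob A \<Longrightarrow> is_kernel A (P X) X (\<epsilon>\<^sub>1 X) (fst (syz X)) (snd (syz X))"
proof -
  assume "X \<in> Ob A"
  then obtain K k where "is_kernel A (P X) X (\<epsilon>\<^sub>1 X) K k"
    using ex_kernel[of "P X" X "\<epsilon>\<^sub>1 X"] by auto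
  hence "case syz X of (K, k) \<Rightarrow> is_kernel A (P X) X (\<epsilon>\<^sub>1 X) K k"
    unfolding syz_def by (intro someI[where P = "\<lambda>(K, k). is_kernel A (P X) X (\<epsilon>\<^sub>1 X) K k" and x = "(K, k)"]) simp
  thus ?thesis by (simp add: case_prod_beta)
qed

abbreviation S :: "'a \<Rightarrow> 'd" where "S X \<equiv> fob f_up (fst (syz X))"

text \<open>
  The inclusion of the syzygy is replaced by its composite with the cover of the syzygy, because \<open>E\<close> can
  only be applied to morphisms between objects of \<open>im f_sh\<close>.
\<close>

definition rel :: "'a \<Rightarrow> 'm" where
  "rel X = Comp A (fob f_sh (S X)) (fst (syz X)) (P X) (snd (syz X)) (\<epsilon>\<^sub>1 (fst (syz X)))"

lemma syz_in [simp]: "X \<in> Ob A \<Longrightarrow> fst (syz X) \<in> Ob A" "X \<in> Ob A \<Longrightarrow> snd (syz X) \<in> Hom A (fst (syz X)) (P X)"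
  using kernelD[OF syz_kernel] by auto

lemma rel_in_hom [simp]: "X \<in> Ob A \<Longrightarrow> rel X \<in> Hom A (fob f_sh (S X)) (P X)"
  by (simp add: rel_def)

lemma cover_epi: "X \<in> Ob A \<Longrightarrow> is_epi A (P X) X (\<epsilon>\<^sub>1 X)"
  by (rule sh.counit_epi[OF faithful_up])

lemma cover_is_cokernel:
  assumes X: "X \<in> Ob A"
  shows "is_cokernel A (fob f_sh (S X)) (P X) (rel X) X (\<epsilon>\<^sub>1 X)"
  unfolding rel_def
  by (rule cokernel_precomp_epi[OF epi_is_cokernel_of_kernel[OF cover_epi[OF X] syz_kernel[OF X]] cover_epi])
    (use X in simp_all)

lemma rel_zero [simp]:
  "X \<in> Ob A \<Longrightarrow> Comp A (fob f_sh (S X)) (P X) X (\<epsilon>\<^sub>1 X) (rel X) = zero_mor A (fob f_sh (S X)) X"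
  using cokernelD(3)[OF cover_is_cokernel] .

text \<open>
  A morphism out of \<open>f_sh Z\<close> that the cover annihilates lands in the syzygy, and by adjunction it lifts
  along the cover of the syzygy: objects of \<open>im f_sh\<close> behave like projectives for these covers.
\<close>

lemma factor_through_rel:
  assumes X: "X \<in> Ob A" and Z: "Z \<in> Ob D" and r: "r \<in> Hom A (fob f_sh Z) (P X)"
    and z: "Comp A (fob f_sh Z) (P X) X (\<epsilon>\<^sub>1 X) r = zero_mor A (fob f_sh Z) X"
  obtains d where "d \<in> Hom D Z (S X)" "r = Comp A (fob f_sh Z) (fob f_sh (S X)) (P X) (rel X) (fmor f_sh Z (S X) d)"
proof -
  obtain u where u: "u \<in> Hom A (fob f_sh Z) (fst (syz X))" "Comp A (fob f_sh Z) (fst (syz X)) (P X) (snd (syz X)) u = r"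
    using kernel_factor[OF syz_kernel[OF X] sh.L.fob_in_Ob[OF Z] r z] .
  obtain d where d: "d \<in> Hom D Z (S X)"
      "Comp A (fob f_sh Z) (fob f_sh (S X)) (fst (syz X)) (\<epsilon>\<^sub>1 (fst (syz X))) (fmor f_sh Z (S X) d) = u"
    using sh.transpose_obtain[OF Z syz_in(1)[OF X] u(1)] .
  have "r = Comp A (fob f_sh Z) (fob f_sh (S X)) (P X) (rel X) (fmor f_sh Z (S X) d)"
    unfolding rel_def using X Z d u by (simp add: comp_assoc)
  with d(1) show ?thesis by (rule that)
qed

text \<open>
  Two morphisms into \<open>P X\<close> with the same composite to \<open>X\<close> differ by a morphism that factors through
  \<open>rel X\<close>, and \<open>t\<close> annihilates the image of such a morphism under \<open>E\<close>. This is what makes \<open>\<nu>\<close> well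
  defined on morphisms although \<open>E\<close> only sees morphisms between covers.
\<close>

lemma E_cong_modulo_rel:
  assumes X: "X \<in> Ob A" and Z: "Z \<in> Ob D" and T: "T \<in> Ob A" and t: "t \<in> Hom A (Q X) T"
    and tz: "Comp A (fob f_st (S X)) (Q X) T t (fmor E (S X) (fob f_up X) (rel X)) = zero_mor A (fob f_st (S X)) T"
    and r: "r \<in> Hom A (fob f_sh Z) (P X)" and s: "s \<in> Hom A (fob f_sh Z) (P X)"
    and eq: "Comp A (fob f_sh Z) (P X) X (\<epsilon>\<^sub>1 X) r = Comp A (fob f_sh Z) (P X) X (\<epsilon>\<^sub>1 X) s"
  shows "Comp A (fob f_st Z) (Q X) T t (fmor E Z (fob f_up X) r) =
    Comp A (fob f_st Z) (Q X) T t (fmor E Z (fob f_up X) s)"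
proof -
  obtain \<delta> where \<delta>: "\<delta> \<in> Hom A (fob f_sh Z) (P X)"
      "Comp A (fob f_sh Z) (P X) X (\<epsilon>\<^sub>1 X) \<delta> = zero_mor A (fob f_sh Z) X"
      "r = add_mor A (fob f_sh Z) (P X) s \<delta>"
    using equalized_differ_by_annihilated[OF sh.L.fob_in_Ob[OF Z] sh.L.fob_in_Ob[OF sh.R.fob_in_Ob[OF X]] X
        sh.counit_in_hom[OF X] r s eq] .
  obtain d where d: "d \<in> Hom D Z (S X)" "\<delta> = Comp A (fob f_sh Z) (fob f_sh (S X)) (P X) (rel X) (fmor f_sh Z (S X) d)"
    using factor_through_rel[OF X Z \<delta>(1,2)] .
  have t\<delta>: "Comp A (fob f_st Z) (Q X) T t (fmor E Z (fob f_up X) \<delta>) = zero_mor A (fob f_st Z) T"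
    unfolding d(2) using X Z T t tz d(1) by (simp add: E_comp comp_assoc[symmetric])
  interpret G: group "HomG A (fob f_st Z) T" using Z T by (simp add: hom_is_group)
  show ?thesis
    unfolding \<delta>(3) using t\<delta> X Z T t s \<delta>(1) by (simp add: E_add comp_distrib_left)
qed

subsection \<open>Construction of the functor\<close>

definition nu_pair :: "'a \<Rightarrow> 'a \<times> 'm" where
  "nu_pair X = (SOME (N, p). is_cokernel A (fob f_st (S X)) (Q X) (fmor E (S X) (fob f_up X) (rel X)) N p)"

abbreviation nu_ob :: "'a \<Rightarrow> 'a" where "nu_ob X \<equiv> fst (nu_pair X)"
abbreviation nu_proj :: "'a \<Rightarrow> 'm" where "nu_proj X \<equiv> snd (nu_pair X)"

lemma nu_cokernel:
  "X \<in> Ob A \<Longrightarrow> is_cokernel A (fob f_st (S X)) (Q X) (fmor E (S X) (fob f_up X) (rel X)) (nu_ob X) (nu_proj X)"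
proof -
  let ?P = "\<lambda>(N, p). is_cokernel A (fob f_st (S X)) (Q X) (fmor E (S X) (fob f_up X) (rel X)) N p"
  assume X: "X \<in> Ob A"
  then obtain N p where "is_cokernel A (fob f_st (S X)) (Q X) (fmor E (S X) (fob f_up X) (rel X)) N p"
    using ex_cokernel[of "fob f_st (S X)" "Q X" "fmor E (S X) (fob f_up X) (rel X)"] by auto
  hence "?P (nu_pair X)"
    unfolding nu_pair_def by (intro someI[where P = ?P and x = "(N, p)"]) simp
  thus ?thesis by (simp add: case_prod_beta)
qed

lemma nu_in [simp]:
  "X \<in> Ob A \<Longrightarrow> nu_ob X \<in> Ob A" "X \<in> Ob A \<Longrightarrow> nu_proj X \<in> Hom A (Q X) (nu_ob X)"
  using cokernelD[OF nu_cokernel] by auto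

lemma nu_proj_epi: "X \<in> Ob A \<Longrightarrow> is_epi A (Q X) (nu_ob X) (nu_proj X)"
  using cokernel_is_epi[OF nu_cokernel] by auto

lemma nu_proj_cancel:
  assumes "Comp A (Q X) (nu_ob X) T g (nu_proj X) = Comp A (Q X) (nu_ob X) T h (nu_proj X)"
    "X \<in> Ob A" "T \<in> Ob A" "g \<in> Hom A (nu_ob X) T" "h \<in> Hom A (nu_ob X) T"
  shows "g = h"
  using epi_cancel[OF nu_proj_epi] assms by blast

definition nu_mor :: "'a \<Rightarrow> 'a \<Rightarrow> 'm \<Rightarrow> 'm" where
  "nu_mor X Y a = (THE u. u \<in> Hom A (nu_ob X) (nu_ob Y) \<and>
     Comp A (Q X) (nu_ob X) (nu_ob Y) u (nu_proj X) =
     Comp A (Q X) (Q Y) (nu_ob Y) (nu_proj Y) (fmor f_st (fob f_up X) (fob f_up Y) (fmor f_up X Y a)))"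

lemma nu_proj_rel:
  "X \<in> Ob A \<Longrightarrow> Comp A (fob f_st (S X)) (Q X) (nu_ob X) (nu_proj X) (fmor E (S X) (fob f_up X) (rel X)) =
    zero_mor A (fob f_st (S X)) (nu_ob X)"
  by (rule cokernelD(3)[OF nu_cokernel])

text \<open>
  The composite of \<open>P a\<close> with \<open>rel X\<close> becomes zero after the cover of \<open>Y\<close>, so \<open>E_cong_modulo_rel\<close>
  compares it with the zero morphism.
\<close>

lemma nu_mor_ex1:
  assumes X: "X \<in> Ob A" and Y: "Y \<in> Ob A" and a: "a \<in> Hom A X Y"
  shows "\<exists>!u. u \<in> Hom A (nu_ob X) (nu_ob Y) \<and>
     Comp A (Q X) (nu_ob X) (nu_ob Y) u (nu_proj X) =
     Comp A (Q X) (Q Y) (nu_ob Y) (nu_proj Y) (fmor f_st (fob f_up X) (fob f_up Y) (fmor f_up X Y a))"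
proof -
  let ?Pa = "fmor f_sh (fob f_up X) (fob f_up Y) (fmor f_up X Y a)"
  let ?Qa = "fmor f_st (fob f_up X) (fob f_up Y) (fmor f_up X Y a)"
  have *: "Comp A (fob f_sh (S X)) (P Y) Y (\<epsilon>\<^sub>1 Y) (Comp A (fob f_sh (S X)) (P X) (P Y) ?Pa (rel X)) =
      Comp A (fob f_sh (S X)) (P Y) Y (\<epsilon>\<^sub>1 Y) (zero_mor A (fob f_sh (S X)) (P Y))"
    using X Y a by (simp add: comp_assoc[symmetric] sh.counit_natural)
      (simp add: comp_assoc)
  have "Comp A (fob f_st (S X)) (Q X) (nu_ob Y) (Comp A (Q X) (Q Y) (nu_ob Y) (nu_proj Y) ?Qa)
        (fmor E (S X) (fob f_up X) (rel X)) =
      Comp A (fob f_st (S X)) (Q Y) (nu_ob Y) (nu_proj Y)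
        (fmor E (S X) (fob f_up Y) (Comp A (fob f_sh (S X)) (P X) (P Y) ?Pa (rel X)))"
    using X Y a by (simp add: E_comp E_shriek comp_assoc)
  also have "\<dots> = Comp A (fob f_st (S X)) (Q Y) (nu_ob Y) (nu_proj Y)
        (fmor E (S X) (fob f_up Y) (zero_mor A (fob f_sh (S X)) (P Y)))"
    by (rule E_cong_modulo_rel[OF Y _ _ _ nu_proj_rel[OF Y] _ _ *]) (use X Y a in auto)
  also have "\<dots> = zero_mor A (fob f_st (S X)) (nu_ob Y)" using X Y by simp
  finally show ?thesis using nu_cokernel[OF X] X Y a unfolding is_cokernel_def by simp
qed

lemma nu_mor:
  assumes "X \<in> Ob A" "Y \<in> Ob A" "a \<in> Hom A X Y"
  shows nu_mor_in_hom [simp]: "nu_mor X Y a \<in> Hom A (nu_ob X) (nu_ob Y)"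
    and nu_mor_proj: "Comp A (Q X) (nu_ob X) (nu_ob Y) (nu_mor X Y a) (nu_proj X) =
     Comp A (Q X) (Q Y) (nu_ob Y) (nu_proj Y) (fmor f_st (fob f_up X) (fob f_up Y) (fmor f_up X Y a))"
  using theI'[OF nu_mor_ex1[OF assms]] unfolding nu_mor_def by auto

definition nu :: "('a, 'm, 'a, 'm) functr" where
  "nu = \<lparr>fob = nu_ob, fmor = nu_mor\<rparr>"

lemma nu_simps [simp]: "fob nu = nu_ob" "fmor nu = nu_mor"
  by (simp_all add: nu_def)

lemma nu_functor: "additive_functor A A nu"
proof (unfold_locales, unfold nu_simps)
  fix X assume X: "X \<in> Ob A"
  show "nu_ob X \<in> Ob A" using X by simp
  show "nu_mor X X (Ident A X) = Ident A (nu_ob X)"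
    by (rule nu_proj_cancel[of X "nu_ob X"]) (use X in \<open>simp_all add: nu_mor_proj\<close>)
next
  fix X Y assume XY: "X \<in> Ob A" "Y \<in> Ob A"
  show "nu_mor X Y \<in> hom (HomG A X Y) (HomG A (nu_ob X) (nu_ob Y))"
  proof (rule homI)
    fix f g assume fg: "f \<in> Hom A X Y" "g \<in> Hom A X Y"
    show "nu_mor X Y f \<in> Hom A (nu_ob X) (nu_ob Y)" using XY fg by simp
    show "nu_mor X Y (add_mor A X Y f g) = add_mor A (nu_ob X) (nu_ob Y) (nu_mor X Y f) (nu_mor X Y g)"
      by (rule nu_proj_cancel[of X "nu_ob Y"])
        (use XY fg in \<open>simp_all add: nu_mor_proj sh.R.fmor_add st.R.fmor_add comp_distrib_left comp_distrib_right\<close>)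
  qed
  fix Z g f assume Z: "Z \<in> Ob A" and gf: "g \<in> Hom A Y Z" "f \<in> Hom A X Y"
  have "Comp A (Q X) (nu_ob X) (nu_ob Z) (Comp A (nu_ob X) (nu_ob Y) (nu_ob Z) (nu_mor Y Z g) (nu_mor X Y f)) (nu_proj X) =
    Comp A (Q X) (Q Y) (nu_ob Z) (Comp A (Q Y) (nu_ob Y) (nu_ob Z) (nu_mor Y Z g) (nu_proj Y))
      (fmor f_st (fob f_up X) (fob f_up Y) (fmor f_up X Y f))"
    using XY Z gf by (simp add: comp_assoc nu_mor_proj[OF XY(1)])
  also have "\<dots> = Comp A (Q X) (nu_ob X) (nu_ob Z) (nu_mor X Z (Comp A X Y Z g f)) (nu_proj X)"
    using XY Z gf by (simp add: nu_mor_proj comp_assoc sh.R.fmor_comp st.R.fmor_comp)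
  finally show "nu_mor X Z (Comp A X Y Z g f) = Comp A (nu_ob X) (nu_ob Y) (nu_ob Z) (nu_mor Y Z g) (nu_mor X Y f)"
    using nu_proj_cancel[of X "nu_ob Z"] XY Z gf by simp
qed

subsection \<open>Morphisms out of the cokernel\<close>

text \<open>
  The bijection between \<open>Hom(\<nu> X, f_st Z)\<close> and \<open>Hom(X, f_sh Z)\<close> as a relation: \<open>E\<close> carries the
  restriction of \<open>y\<close> to the cover \<open>P X\<close> to the restriction of \<open>g\<close> to \<open>Q X\<close>.
\<close>

definition mate :: "'a \<Rightarrow> 'd \<Rightarrow> 'm \<Rightarrow> 'm \<Rightarrow> bool" where
  "mate X Z g y \<longleftrightarrow> Comp A (Q X) (nu_ob X) (fob f_st Z) g (nu_proj X) =
     fmor E (fob f_up X) Z (Comp A (P X) X (fob f_sh Z) y (\<epsilon>\<^sub>1 X))"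

lemma mate_ex_left:
  assumes X: "X \<in> Ob A" and Z: "Z \<in> Ob D" and y: "y \<in> Hom A X (fob f_sh Z)"
  obtains g where "g \<in> Hom A (nu_ob X) (fob f_st Z)" "mate X Z g y"
proof -
  let ?t = "fmor E (fob f_up X) Z (Comp A (P X) X (fob f_sh Z) y (\<epsilon>\<^sub>1 X))"
  have t: "?t \<in> Hom A (Q X) (fob f_st Z)" using X Z y by simp
  have tz: "Comp A (fob f_st (S X)) (Q X) (fob f_st Z) ?t (fmor E (S X) (fob f_up X) (rel X)) =
      zero_mor A (fob f_st (S X)) (fob f_st Z)"
    using X Z y by (simp add: E_comp[symmetric] comp_assoc)
  show ?thesis
    using cokernel_factor[OF nu_cokernel[OF X] st.R.fob_in_Ob[OF Z] t tz] that
    unfolding mate_def .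
qed

text \<open>
  Here fullness and faithfulness of \<open>E\<close> are used: the restriction of \<open>g\<close> to \<open>Q X\<close> has a preimage \<open>h\<close>, and
  \<open>h\<close> annihilates \<open>rel X\<close> because its image under \<open>E\<close> annihilates \<open>E (rel X)\<close>.
\<close>

lemma mate_ex_right:
  assumes X: "X \<in> Ob A" and Z: "Z \<in> Ob D" and g: "g \<in> Hom A (nu_ob X) (fob f_st Z)"
  obtains y where "y \<in> Hom A X (fob f_sh Z)" "mate X Z g y"
proof -
  have gp: "Comp A (Q X) (nu_ob X) (fob f_st Z) g (nu_proj X) \<in> Hom A (Q X) (fob f_st Z)"
    using X Z g by simp
  obtain h where h: "h \<in> Hom A (P X) (fob f_sh Z)"
      "fmor E (fob f_up X) Z h = Comp A (Q X) (nu_ob X) (fob f_st Z) g (nu_proj X)"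
    using E_surj[OF sh.R.fob_in_Ob[OF X] Z gp] .
  have hz: "Comp A (fob f_sh (S X)) (P X) (fob f_sh Z) h (rel X) = zero_mor A (fob f_sh (S X)) (fob f_sh Z)"
    by (rule E_inj[of "S X" Z]) (use X Z g h in \<open>simp_all add: E_comp comp_assoc nu_proj_rel\<close>)
  obtain y where "y \<in> Hom A X (fob f_sh Z)" "Comp A (P X) X (fob f_sh Z) y (\<epsilon>\<^sub>1 X) = h"
    using cokernel_factor[OF cover_is_cokernel[OF X] sh.L.fob_in_Ob[OF Z] h(1) hz] .
  thus ?thesis using that h(2) unfolding mate_def by simp
qed

lemma mate_unique_left:
  assumes "mate X Z g y" "mate X Z h y" "X \<in> Ob A" "Z \<in> Ob D"
    "g \<in> Hom A (nu_ob X) (fob f_st Z)" "h \<in> Hom A (nu_ob X) (fob f_st Z)"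
  shows "g = h"
  using assms nu_proj_cancel[of X "fob f_st Z" g h] unfolding mate_def by simp

lemma mate_unique_right:
  assumes m: "mate X Z g y" "mate X Z g z" and X: "X \<in> Ob A" and Z: "Z \<in> Ob D"
    and yz: "y \<in> Hom A X (fob f_sh Z)" "z \<in> Hom A X (fob f_sh Z)"
  shows "y = z"
proof (rule epi_cancel[OF cover_epi[OF X], of "fob f_sh Z" y z])
  show "Comp A (P X) X (fob f_sh Z) y (\<epsilon>\<^sub>1 X) = Comp A (P X) X (fob f_sh Z) z (\<epsilon>\<^sub>1 X)"
    by (rule E_inj[of "fob f_up X" Z]) (use m X Z yz in \<open>simp_all add: mate_def\<close>)
qed (use Z yz in simp_all)

lemma mate_precomp:
  assumes m: "mate Y Z g y" and X: "X \<in> Ob A" and Y: "Y \<in> Ob A" and Z: "Z \<in> Ob D"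
    and g: "g \<in> Hom A (nu_ob Y) (fob f_st Z)" and y: "y \<in> Hom A Y (fob f_sh Z)" and a: "a \<in> Hom A X Y"
  shows "mate X Z (Comp A (nu_ob X) (nu_ob Y) (fob f_st Z) g (nu_mor X Y a)) (Comp A X Y (fob f_sh Z) y a)"
proof -
  let ?Pa = "fmor f_sh (fob f_up X) (fob f_up Y) (fmor f_up X Y a)"
  let ?Qa = "fmor f_st (fob f_up X) (fob f_up Y) (fmor f_up X Y a)"
  have "Comp A (Q X) (nu_ob X) (fob f_st Z) (Comp A (nu_ob X) (nu_ob Y) (fob f_st Z) g (nu_mor X Y a)) (nu_proj X) =
      Comp A (Q X) (Q Y) (fob f_st Z) (Comp A (Q Y) (nu_ob Y) (fob f_st Z) g (nu_proj Y)) ?Qa"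
    using X Y Z g a by (simp add: comp_assoc nu_mor_proj)
  also have "\<dots> = fmor E (fob f_up X) Z (Comp A (P X) (P Y) (fob f_sh Z) (Comp A (P Y) Y (fob f_sh Z) y (\<epsilon>\<^sub>1 Y)) ?Pa)"
    using m[unfolded mate_def] X Y Z g y a by (simp add: E_comp E_shriek)
  also have "Comp A (P X) (P Y) (fob f_sh Z) (Comp A (P Y) Y (fob f_sh Z) y (\<epsilon>\<^sub>1 Y)) ?Pa =
      Comp A (P X) X (fob f_sh Z) (Comp A X Y (fob f_sh Z) y a) (\<epsilon>\<^sub>1 X)"
    using X Y Z y a by (simp add: comp_assoc sh.counit_natural)
  finally show ?thesis unfolding mate_def .
qed

lemma mate_postcomp:
  assumes m: "mate X Y g y" and X: "X \<in> Ob A" and Y: "Y \<in> Ob D" and Z: "Z \<in> Ob D"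
    and g: "g \<in> Hom A (nu_ob X) (fob f_st Y)" and y: "y \<in> Hom A X (fob f_sh Y)"
    and b: "b \<in> Hom A (fob f_sh Y) (fob f_sh Z)"
  shows "mate X Z (Comp A (nu_ob X) (fob f_st Y) (fob f_st Z) (fmor E Y Z b) g)
    (Comp A X (fob f_sh Y) (fob f_sh Z) b y)"
  using m X Y Z g y b by (simp add: mate_def comp_assoc E_comp)

lemma mate_zero:
  assumes X: "X \<in> Ob A" and Z: "Z \<in> Ob D"
  shows "mate X Z (zero_mor A (nu_ob X) (fob f_st Z)) (zero_mor A X (fob f_sh Z))"
  using X Z by (simp add: mate_def)

subsection \<open>The restriction\<close>

text \<open>
  The identification of \<open>\<nu> f_sh Z\<close> with \<open>f_st Z\<close> is the mate of the identity of \<open>f_sh Z\<close>.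
\<close>

definition iota :: "'d \<Rightarrow> 'm" where
  "iota Z = (SOME g. g \<in> Hom A (nu_ob (fob f_sh Z)) (fob f_st Z) \<and>
     mate (fob f_sh Z) Z g (Ident A (fob f_sh Z)))"

lemma iota:
  assumes "Z \<in> Ob D"
  shows iota_in_hom [simp]: "iota Z \<in> Hom A (nu_ob (fob f_sh Z)) (fob f_st Z)"
    and iota_mate: "mate (fob f_sh Z) Z (iota Z) (Ident A (fob f_sh Z))"
proof -
  have Z: "fob f_sh Z \<in> Ob A" using assms by simp
  have "\<exists>g. g \<in> Hom A (nu_ob (fob f_sh Z)) (fob f_st Z) \<and> mate (fob f_sh Z) Z g (Ident A (fob f_sh Z))"
    by (rule mate_ex_left[OF Z assms ident_in_hom[OF Z]]) blast
  from someI_ex[OF this] show "iota Z \<in> Hom A (nu_ob (fob f_sh Z)) (fob f_st Z)"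
    "mate (fob f_sh Z) Z (iota Z) (Ident A (fob f_sh Z))" unfolding iota_def by auto
qed

lemma iota_proj:
  "Z \<in> Ob D \<Longrightarrow> Comp A (Q (fob f_sh Z)) (nu_ob (fob f_sh Z)) (fob f_st Z) (iota Z) (nu_proj (fob f_sh Z)) =
    fmor E (fob f_up (fob f_sh Z)) Z (\<epsilon>\<^sub>1 (fob f_sh Z))"
  using iota_mate[of Z] by (simp add: mate_def)

lemma iota_nu_mor_mate:
  assumes X: "X \<in> Ob A" and Z: "Z \<in> Ob D" and y: "y \<in> Hom A X (fob f_sh Z)"
  shows "mate X Z (Comp A (nu_ob X) (nu_ob (fob f_sh Z)) (fob f_st Z) (iota Z) (nu_mor X (fob f_sh Z) y)) y"
  using mate_precomp[OF iota_mate[OF Z] X _ Z _ _ y] assms by simp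

text \<open>
  The cover of \<open>f_sh Z\<close> is split by \<open>f_sh\<close> applied to the unit. Applying \<open>E\<close> to the section \<open>s\<close> and
  projecting to the cokernel gives the inverse: \<open>s\<close> after the cover need not be the identity of
  \<open>P (f_sh Z)\<close>, but it agrees with it modulo \<open>rel\<close>.
\<close>

lemma iota_iso:
  assumes Z: "Z \<in> Ob D"
  shows "is_iso A (nu_ob (fob f_sh Z)) (fob f_st Z) (iota Z)"
proof -
  let ?X = "fob f_sh Z" and ?fX = "fob f_up (fob f_sh Z)"
  let ?s = "fmor f_sh Z ?fX (\<eta>\<^sub>1 Z)"
  let ?j = "Comp A (fob f_st Z) (Q ?X) (nu_ob ?X) (nu_proj ?X) (fmor E Z ?fX ?s)"
  have "Comp A (fob f_st Z) (nu_ob ?X) (fob f_st Z) (iota Z) ?j =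
      fmor E Z Z (Comp A ?X (P ?X) ?X (\<epsilon>\<^sub>1 ?X) ?s)"
    using Z by (simp add: comp_assoc[symmetric] iota_proj E_comp del: sh.triangle_left)
  hence 1: "Comp A (fob f_st Z) (nu_ob ?X) (fob f_st Z) (iota Z) ?j = Ident A (fob f_st Z)"
    using Z by simp
  have "Comp A (Q ?X) (nu_ob ?X) (nu_ob ?X) (Comp A (nu_ob ?X) (fob f_st Z) (nu_ob ?X) ?j (iota Z)) (nu_proj ?X) =
      Comp A (Q ?X) (Q ?X) (nu_ob ?X) (nu_proj ?X) (fmor E ?fX ?fX (Comp A (P ?X) ?X (P ?X) ?s (\<epsilon>\<^sub>1 ?X)))"
    using Z by (simp add: comp_assoc iota_proj E_comp)
  also have "\<dots> = Comp A (Q ?X) (Q ?X) (nu_ob ?X) (nu_proj ?X) (fmor E ?fX ?fX (Ident A (P ?X)))"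
    by (rule E_cong_modulo_rel[OF _ _ _ _ nu_proj_rel]) (use Z in \<open>simp_all add: comp_assoc[symmetric]\<close>)
  also have "\<dots> = Comp A (Q ?X) (nu_ob ?X) (nu_ob ?X) (Ident A (nu_ob ?X)) (nu_proj ?X)" using Z by simp
  finally have 2: "Comp A (nu_ob ?X) (fob f_st Z) (nu_ob ?X) ?j (iota Z) = Ident A (nu_ob ?X)"
    by (rule nu_proj_cancel) (use Z in simp_all)
  show ?thesis unfolding is_iso_def
    by (intro conjI bexI[where x = ?j]) (use Z 1 2 in auto)
qed

text \<open>
  Both sides are mates of \<open>g\<close>.
\<close>

lemma iota_E:
  assumes X: "X \<in> Ob D" and Y: "Y \<in> Ob D" and g: "g \<in> Hom A (fob f_sh X) (fob f_sh Y)"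
  shows "Comp A (nu_ob (fob f_sh X)) (nu_ob (fob f_sh Y)) (fob f_st Y) (iota Y) (nu_mor (fob f_sh X) (fob f_sh Y) g) =
    Comp A (nu_ob (fob f_sh X)) (fob f_st X) (fob f_st Y) (fmor E X Y g) (iota X)"
proof (rule mate_unique_left[of "fob f_sh X" Y _ g])
  show "mate (fob f_sh X) Y (Comp A (nu_ob (fob f_sh X)) (nu_ob (fob f_sh Y)) (fob f_st Y) (iota Y)
      (nu_mor (fob f_sh X) (fob f_sh Y) g)) g"
    using iota_nu_mor_mate[OF _ Y g] X by simp
  show "mate (fob f_sh X) Y (Comp A (nu_ob (fob f_sh X)) (fob f_st X) (fob f_st Y) (fmor E X Y g) (iota X)) g"
    using mate_postcomp[OF iota_mate[OF X] _ X Y _ _ g] X Y g by simp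
qed (use X Y g in simp_all)

lemma nu_restricts: "restricts_to A D f_sh f_st E nu iota"
proof -
  have "nat_trans D A (nu \<circ>\<^sub>F f_sh) f_st iota"
    unfolding nat_trans_def comp_functor_def using iota_E E_shriek by simp
  thus ?thesis unfolding restricts_to_def nat_iso_def
    using iota_iso iota_E by (simp add: comp_functor_def)
qed

text \<open>
  Up to the isomorphism \<open>iota Z\<close> the map is the inverse of the mate bijection, by \<open>iota_nu_mor_mate\<close>.
\<close>

lemma nu_fully_faithful_into_image:
  assumes X: "X \<in> Ob A" and Z: "Z \<in> Ob D"
  shows "bij_betw (nu_mor X (fob f_sh Z)) (Hom A X (fob f_sh Z)) (Hom A (nu_ob X) (nu_ob (fob f_sh Z)))"
  unfolding bij_betw_def
proof (intro conjI inj_onI equalityI subsetI)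
  fix y z assume yz: "y \<in> Hom A X (fob f_sh Z)" "z \<in> Hom A X (fob f_sh Z)"
    and "nu_mor X (fob f_sh Z) y = nu_mor X (fob f_sh Z) z"
  thus "y = z" using iota_nu_mor_mate[OF X Z] mate_unique_right[OF _ _ X Z] by metis
next
  fix h assume h: "h \<in> Hom A (nu_ob X) (nu_ob (fob f_sh Z))"
  have "Comp A (nu_ob X) (nu_ob (fob f_sh Z)) (fob f_st Z) (iota Z) h \<in> Hom A (nu_ob X) (fob f_st Z)"
    using X Z h by simp
  then obtain y where y: "y \<in> Hom A X (fob f_sh Z)"
      "mate X Z (Comp A (nu_ob X) (nu_ob (fob f_sh Z)) (fob f_st Z) (iota Z) h) y"
    by (rule mate_ex_right[OF X Z])
  have "Comp A (nu_ob X) (nu_ob (fob f_sh Z)) (fob f_st Z) (iota Z) h =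
      Comp A (nu_ob X) (nu_ob (fob f_sh Z)) (fob f_st Z) (iota Z) (nu_mor X (fob f_sh Z) y)"
    by (rule mate_unique_left[OF y(2) iota_nu_mor_mate[OF X Z y(1)] X Z]) (use X Z h y(1) in simp_all)
  hence "h = nu_mor X (fob f_sh Z) y"
    by (rule iota_iso[OF Z, THEN iso_cancel_left, rotated -1]) (use X Z h y(1) in simp_all)
  thus "h \<in> nu_mor X (fob f_sh Z) ` Hom A X (fob f_sh Z)" using y(1) by blast
qed (use X Z in auto)

subsection \<open>The right adjoint\<close>

text \<open>
  The monomorphism \<open>m: B \<rightarrow> Q B\<close> is the kernel of its cokernel \<open>q: Q B \<rightarrow> C\<close>, hence also of the composite
  \<open>e\<close> of \<open>q\<close> with \<open>C \<rightarrow> Q C\<close>, which has the advantage of being a morphism of \<open>im f_st\<close>. With \<open>e'\<close> the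
  \<open>E\<close>-preimage of \<open>e\<close> and \<open>j: R \<rightarrow> P B\<close> its kernel, mates identify morphisms \<open>\<nu> X \<rightarrow> B\<close>, viewed as
  morphisms to \<open>Q B\<close> annihilated by \<open>e\<close>, with morphisms \<open>X \<rightarrow> P B\<close> annihilated by \<open>e'\<close>, that is, with
  morphisms \<open>X \<rightarrow> R\<close>. The universal arrow \<open>c\<close> corresponds to the identity of \<open>R\<close>.
\<close>

lemma nu_universal_arrow:
  assumes B: "B \<in> Ob A"
  obtains R c where "R \<in> Ob A" "c \<in> Hom A (nu_ob R) B"
    "\<And>X g. X \<in> Ob A \<Longrightarrow> g \<in> Hom A (nu_ob X) B \<Longrightarrow>
      \<exists>!a. a \<in> Hom A X R \<and> Comp A (nu_ob X) (nu_ob R) B c (nu_mor X R a) = g"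
proof -
  let ?m = "\<eta>\<^sub>2 B" and ?fB = "fob f_up B"
  have m: "is_mono A B (Q B) ?m" by (rule st.unit_mono[OF faithful_up B])
  have fB: "?fB \<in> Ob D" and QB: "Q B \<in> Ob A" and PB: "P B \<in> Ob A" using B by simp_all
  obtain C q where q: "is_cokernel A B (Q B) ?m C q" using ex_cokernel[OF B QB st.unit_in_hom[OF B]] by blast
  note qD = cokernelD[OF q]
  let ?fC = "fob f_up C"
  let ?e = "Comp A (Q B) C (Q C) (\<eta>\<^sub>2 C) q"
  have fC: "?fC \<in> Ob D" and PC: "P C \<in> Ob A" using qD by simp_all
  have e: "?e \<in> Hom A (Q B) (Q C)" using B qD by simp
  have em: "Comp A B (Q B) (Q C) ?e ?m = zero_mor A B (Q C)" using B qD by (simp add: comp_assoc)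
  have e_factor: "\<exists>u \<in> Hom A T B. Comp A T B (Q B) ?m u = t"
    if T: "T \<in> Ob A" and t: "t \<in> Hom A T (Q B)" and z: "Comp A T (Q B) (Q C) ?e t = zero_mor A T (Q C)" for T t
  proof -
    have qt: "Comp A T (Q B) C q t = zero_mor A T C"
      by (rule mono_cancel[OF st.unit_mono[OF faithful_up qD(1)], where W = T])
        (use B qD T t z in \<open>simp_all add: comp_assoc\<close>)
    show ?thesis by (rule kernel_factor[OF mono_is_kernel_of_cokernel[OF m q B QB] T t qt]) blast
  qed
  obtain e' where e': "e' \<in> Hom A (P B) (P C)" "fmor E ?fB ?fC e' = ?e"
    using E_surj[OF fB fC e] .
  obtain R j where j: "is_kernel A (P B) (P C) e' R j"
    using ex_kernel[OF PB PC e'(1)] by blast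
  note jD = kernelD[OF j]
  have j_mono: "is_mono A R (P B) j" using kernel_is_mono[OF j PB PC e'(1)] .
  obtain g\<^sub>0 where g\<^sub>0: "g\<^sub>0 \<in> Hom A (nu_ob R) (Q B)" "mate R ?fB g\<^sub>0 j"
    using mate_ex_left[OF jD(1) fB jD(2)] .
  have eg\<^sub>0: "Comp A (nu_ob R) (Q B) (Q C) ?e g\<^sub>0 = zero_mor A (nu_ob R) (Q C)"
  proof (rule mate_unique_left[of R ?fC])
    show "mate R ?fC (Comp A (nu_ob R) (Q B) (Q C) ?e g\<^sub>0) (zero_mor A R (P C))"
      using mate_postcomp[OF g\<^sub>0(2) jD(1) _ _ g\<^sub>0(1) jD(2) e'(1)] e'(2) B qD jD by simp
    show "mate R ?fC (zero_mor A (nu_ob R) (Q C)) (zero_mor A R (P C))"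
      using mate_zero[OF jD(1)] qD by simp
  qed (use B qD jD g\<^sub>0 in simp_all)
  obtain c where c: "c \<in> Hom A (nu_ob R) B" "Comp A (nu_ob R) B (Q B) ?m c = g\<^sub>0"
    using e_factor[OF nu_in(1)[OF jD(1)] g\<^sub>0(1) eg\<^sub>0] by blast
  have "\<exists>!a. a \<in> Hom A X R \<and> Comp A (nu_ob X) (nu_ob R) B c (nu_mor X R a) = g"
    if X: "X \<in> Ob A" and g: "g \<in> Hom A (nu_ob X) B" for X g
  proof -
    let ?g = "Comp A (nu_ob X) B (Q B) ?m g"
    have g': "?g \<in> Hom A (nu_ob X) (Q B)" using X B g by simp
    have eg: "Comp A (nu_ob X) (Q B) (Q C) ?e ?g = zero_mor A (nu_ob X) (Q C)"
      using X B g qD em by (simp add: comp_assoc[symmetric])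
    obtain y where y: "y \<in> Hom A X (P B)" "mate X ?fB ?g y"
      using mate_ex_right[OF X fB g'] .
    have e'y: "Comp A X (P B) (P C) e' y = zero_mor A X (P C)"
    proof (rule mate_unique_right[of X ?fC])
      show "mate X ?fC (zero_mor A (nu_ob X) (Q C)) (Comp A X (P B) (P C) e' y)"
        using mate_postcomp[OF y(2) X _ _ g' y(1) e'(1)] e'(2) eg B qD by simp
      show "mate X ?fC (zero_mor A (nu_ob X) (Q C)) (zero_mor A X (P C))"
        using mate_zero[OF X] qD by simp
    qed (use X B qD y e' in simp_all)
    obtain a where a: "a \<in> Hom A X R" "Comp A X R (P B) j a = y"
      using kernel_factor[OF j X y(1) e'y] .
    have key: "Comp A (nu_ob X) (nu_ob R) B c (nu_mor X R b) = g \<longleftrightarrow> Comp A X R (P B) j b = y"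
      if b: "b \<in> Hom A X R" for b
    proof -
      have mb: "mate X ?fB (Comp A (nu_ob X) (nu_ob R) (Q B) g\<^sub>0 (nu_mor X R b)) (Comp A X R (P B) j b)"
        using mate_precomp[OF g\<^sub>0(2) X jD(1) _ g\<^sub>0(1) jD(2) b] B by simp
      have g\<^sub>0b: "Comp A (nu_ob X) (nu_ob R) (Q B) g\<^sub>0 (nu_mor X R b) =
          Comp A (nu_ob X) B (Q B) ?m (Comp A (nu_ob X) (nu_ob R) B c (nu_mor X R b))"
        unfolding c(2)[symmetric] using X B jD c(1) b by (simp add: comp_assoc)
      have "Comp A (nu_ob X) (nu_ob R) B c (nu_mor X R b) = g \<longleftrightarrow>
          Comp A (nu_ob X) (nu_ob R) (Q B) g\<^sub>0 (nu_mor X R b) = ?g"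
        unfolding g\<^sub>0b using mono_cancel[OF m, where W = "nu_ob X" and h = g] X B jD c(1) b g by force
      also have "\<dots> \<longleftrightarrow> Comp A X R (P B) j b = y"
      proof
        assume "Comp A (nu_ob X) (nu_ob R) (Q B) g\<^sub>0 (nu_mor X R b) = ?g"
        thus "Comp A X R (P B) j b = y"
          using mb y(2) by (intro mate_unique_right[OF _ _ X fB]) (use y X B jD b in simp_all)
      next
        assume "Comp A X R (P B) j b = y"
        thus "Comp A (nu_ob X) (nu_ob R) (Q B) g\<^sub>0 (nu_mor X R b) = ?g"
          using mb y(2) by (intro mate_unique_left[OF _ _ X fB]) (use y X B jD b g\<^sub>0(1) g' in simp_all)
      qed
      finally show ?thesis .
    qed
    show ?thesis
    proof (rule ex1I[of _ a])
      show "a \<in> Hom A X R \<and> Comp A (nu_ob X) (nu_ob R) B c (nu_mor X R a) = g" using a key by simp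
      fix b assume "b \<in> Hom A X R \<and> Comp A (nu_ob X) (nu_ob R) B c (nu_mor X R b) = g"
      hence b: "b \<in> Hom A X R" "Comp A X R (P B) j b = Comp A X R (P B) j a" using key a by auto
      show "b = a" by (rule mono_cancel[OF j_mono b(2) X b(1) a(1)])
    qed
  qed
  with jD(1) c(1) show ?thesis by (rule that)
qed

lemma nu_right_adjoint: "\<exists>R \<eta> \<epsilon>. adjunction A A nu R \<eta> \<epsilon>"
proof -
  have "\<forall>B. \<exists>R c. B \<in> Ob A \<longrightarrow> R \<in> Ob A \<and> c \<in> Hom A (nu_ob R) B \<and>
      (\<forall>X g. X \<in> Ob A \<longrightarrow> g \<in> Hom A (nu_ob X) B \<longrightarrow>
        (\<exists>!a. a \<in> Hom A X R \<and> Comp A (nu_ob X) (nu_ob R) B c (nu_mor X R a) = g))"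
    using nu_universal_arrow by metis
  then obtain r c where rc: "\<And>B. B \<in> Ob A \<Longrightarrow> r B \<in> Ob A \<and> c B \<in> Hom A (nu_ob (r B)) B \<and>
      (\<forall>X g. X \<in> Ob A \<longrightarrow> g \<in> Hom A (nu_ob X) B \<longrightarrow>
        (\<exists>!a. a \<in> Hom A X (r B) \<and> Comp A (nu_ob X) (nu_ob (r B)) B (c B) (nu_mor X (r B) a) = g))"
    by metis
  have "\<exists>R \<eta>. adjunction A A nu R \<eta> c"
    by (rule adjunction_of_universal_arrows[OF nu_functor, of r]) (use rc in auto)
  thus ?thesis by blast
qed

lemma nu_nakayama: "nakayama_functor A D f_sh f_up nu"
proof -
  obtain R \<eta> \<epsilon> where adj: "adjunction A A nu R \<eta> \<epsilon>" using nu_right_adjoint by blast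
  interpret nu: adjoint_pair A A nu R \<eta> \<epsilon> using adjunction_imp_adjoint_pair[OF adj] .
  have "\<exists>\<eta>' \<epsilon>'. adjunction A D f_up (nu \<circ>\<^sub>F f_sh) \<eta>' \<epsilon>'"
    using st.right_adjoint_iso_invariant additive_functor_comp[OF sh.L.additive_functor_axioms nu_functor]
      nu_restricts unfolding restricts_to_def by blast
  moreover have "nat_trans D A f_sh (R \<circ>\<^sub>F nu \<circ>\<^sub>F f_sh) (\<lambda>X. \<eta> (fob f_sh X))"
    using nu.unit_in_hom nu.unit_natural by (simp add: nat_trans_def comp_functor_def)
  moreover have "is_iso A (fob f_sh Z) (fob R (nu_ob (fob f_sh Z))) (\<eta> (fob f_sh Z))" if "Z \<in> Ob D" for Z
    using nu.unit_is_iso[of "fob f_sh Z"] nu_fully_faithful_into_image that by simp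
  ultimately show ?thesis unfolding nakayama_functor_def nat_iso_def
    using adj by (auto simp: comp_functor_def)
qed

subsection \<open>Uniqueness\<close>

text \<open>
  The common feature of Nakayama functors and right exact functors that matters for uniqueness: they
  extend \<open>E\<close> and preserve the chosen presentations.
\<close>

definition presented_extension :: "('a, 'm, 'a, 'm) functr \<Rightarrow> ('d \<Rightarrow> 'm) \<Rightarrow> bool" where
  "presented_extension \<mu> \<iota> \<longleftrightarrow> additive_functor A A \<mu> \<and> restricts_to A D f_sh f_st E \<mu> \<iota> \<and>
     (\<forall>X \<in> Ob A. is_cokernel A (fob \<mu> (fob f_sh (S X))) (fob \<mu> (P X)) (fmor \<mu> (fob f_sh (S X)) (P X) (rel X))
        (fob \<mu> X) (fmor \<mu> (P X) X (\<epsilon>\<^sub>1 X)))"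

definition identified :: "('a, 'm, 'a, 'm) functr \<Rightarrow> ('d \<Rightarrow> 'm) \<Rightarrow> ('a, 'm, 'a, 'm) functr \<Rightarrow> ('d \<Rightarrow> 'm) \<Rightarrow> ('a \<Rightarrow> 'm) \<Rightarrow> bool"
  where "identified \<mu> \<iota> \<mu>' \<iota>' \<zeta> \<longleftrightarrow> (\<forall>Z \<in> Ob D.
    Comp A (fob \<mu> (fob f_sh Z)) (fob \<mu>' (fob f_sh Z)) (fob f_st Z) (\<iota>' Z) (\<zeta> (fob f_sh Z)) = \<iota> Z)"

lemma restrictsD:
  assumes "restricts_to A D f_sh f_st E \<mu> \<iota>" and Z: "Z \<in> Ob D"
  shows "\<iota> Z \<in> Hom A (fob \<mu> (fob f_sh Z)) (fob f_st Z)"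
    and "is_iso A (fob \<mu> (fob f_sh Z)) (fob f_st Z) (\<iota> Z)"
    and "W \<in> Ob D \<Longrightarrow> g \<in> Hom A (fob f_sh Z) (fob f_sh W) \<Longrightarrow>
      Comp A (fob \<mu> (fob f_sh Z)) (fob \<mu> (fob f_sh W)) (fob f_st W) (\<iota> W) (fmor \<mu> (fob f_sh Z) (fob f_sh W) g) =
      Comp A (fob \<mu> (fob f_sh Z)) (fob f_st Z) (fob f_st W) (fmor E Z W g) (\<iota> Z)"
  using assms by (simp_all add: restricts_to_def nat_iso_def is_iso_def comp_functor_def)

lemma presented_epi:
  assumes e: "presented_extension \<mu> \<iota>" and X: "X \<in> Ob A"
  shows "is_epi A (fob \<mu> (P X)) (fob \<mu> X) (fmor \<mu> (P X) X (\<epsilon>\<^sub>1 X))"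
proof -
  interpret m: additive_functor A A \<mu> using e by (simp add: presented_extension_def)
  have "is_cokernel A (fob \<mu> (fob f_sh (S X))) (fob \<mu> (P X)) (fmor \<mu> (fob f_sh (S X)) (P X) (rel X))
      (fob \<mu> X) (fmor \<mu> (P X) X (\<epsilon>\<^sub>1 X))" using e X by (simp add: presented_extension_def)
  thus ?thesis by (rule cokernel_is_epi) (use X in simp_all)
qed

text \<open>
  The identifications determine the component at \<open>P X\<close>, and naturality along the epimorphic image of
  the cover then determines the component at \<open>X\<close>.
\<close>

lemma identified_transformation_unique:
  assumes e: "presented_extension \<mu> \<iota>" and e': "presented_extension \<mu>' \<iota>'"
    and \<zeta>: "nat_trans A A \<mu> \<mu>' \<zeta>" "identified \<mu> \<iota> \<mu>' \<iota>' \<zeta>"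
    and \<xi>: "nat_trans A A \<mu> \<mu>' \<xi>" "identified \<mu> \<iota> \<mu>' \<iota>' \<xi>"
    and X: "X \<in> Ob A"
  shows "\<zeta> X = \<xi> X"
proof -
  interpret m: additive_functor A A \<mu> using e by (simp add: presented_extension_def)
  interpret m': additive_functor A A \<mu>' using e' by (simp add: presented_extension_def)
  have r': "restricts_to A D f_sh f_st E \<mu>' \<iota>'" using e' by (simp add: presented_extension_def)
  let ?Z = "fob f_up X"
  have in_hom: "\<zeta> Y \<in> Hom A (fob \<mu> Y) (fob \<mu>' Y)" "\<xi> Y \<in> Hom A (fob \<mu> Y) (fob \<mu>' Y)"
    if "Y \<in> Ob A" for Y using \<zeta>(1) \<xi>(1) that by (simp_all add: nat_trans_def)
  have P: "\<zeta> (P X) = \<xi> (P X)"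
    by (rule iso_cancel_left[OF restrictsD(2)[OF r', of ?Z], where X = "fob \<mu> (P X)"])
      (use X in_hom \<zeta>(2) \<xi>(2) in \<open>simp_all add: identified_def\<close>)
  have "Comp A (fob \<mu> (P X)) (fob \<mu> X) (fob \<mu>' X) (\<zeta> X) (fmor \<mu> (P X) X (\<epsilon>\<^sub>1 X)) =
      Comp A (fob \<mu> (P X)) (fob \<mu> X) (fob \<mu>' X) (\<xi> X) (fmor \<mu> (P X) X (\<epsilon>\<^sub>1 X))"
    using \<zeta>(1) \<xi>(1) P X by (simp add: nat_trans_def)
  thus ?thesis
    by (rule epi_cancel[OF presented_epi[OF e X]]) (use X in_hom in simp_all)
qed

text \<open>
  On \<open>im f_sh\<close> there is only one candidate, \<open>\<kappa> = \<iota>'\<inverse> \<circ> \<iota>\<close>; it is natural for all morphisms between objects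
  of \<open>im f_sh\<close> because both functors restrict to \<open>E\<close> there. The component at \<open>X\<close> is induced by \<open>\<kappa>\<close>
  on the cokernels of \<open>rel X\<close>.
\<close>

lemma identified_transformation_exists:
  assumes e: "presented_extension \<mu> \<iota>" and e': "presented_extension \<mu>' \<iota>'"
  obtains \<zeta> where "nat_trans A A \<mu> \<mu>' \<zeta>" "identified \<mu> \<iota> \<mu>' \<iota>' \<zeta>"
proof -
  interpret m: additive_functor A A \<mu> using e by (simp add: presented_extension_def)
  interpret m': additive_functor A A \<mu>' using e' by (simp add: presented_extension_def)
  have r: "restricts_to A D f_sh f_st E \<mu> \<iota>" and r': "restricts_to A D f_sh f_st E \<mu>' \<iota>'"
    using e e' by (simp_all add: presented_extension_def)
  have \<iota> [simp]: "\<iota> Z \<in> Hom A (fob \<mu> (fob f_sh Z)) (fob f_st Z)"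
    and \<iota>' [simp]: "\<iota>' Z \<in> Hom A (fob \<mu>' (fob f_sh Z)) (fob f_st Z)" if "Z \<in> Ob D" for Z
    using restrictsD(1)[OF r that] restrictsD(1)[OF r' that] by simp_all
  have "\<exists>k. k \<in> Hom A (fob \<mu> (fob f_sh Z)) (fob \<mu>' (fob f_sh Z)) \<and>
      Comp A (fob \<mu> (fob f_sh Z)) (fob \<mu>' (fob f_sh Z)) (fob f_st Z) (\<iota>' Z) k = \<iota> Z" if Z: "Z \<in> Ob D" for Z
  proof -
    obtain j where j: "j \<in> Hom A (fob f_st Z) (fob \<mu>' (fob f_sh Z))"
        "Comp A (fob f_st Z) (fob \<mu>' (fob f_sh Z)) (fob f_st Z) (\<iota>' Z) j = Ident A (fob f_st Z)"
      using restrictsD(2)[OF r' Z] by (rule is_isoE)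
    show ?thesis
      by (rule exI[of _ "Comp A (fob \<mu> (fob f_sh Z)) (fob f_st Z) (fob \<mu>' (fob f_sh Z)) j (\<iota> Z)"])
        (use Z j in \<open>simp add: comp_assoc[symmetric]\<close>)
  qed
  then obtain \<kappa> where \<kappa> [simp]: "\<And>Z. Z \<in> Ob D \<Longrightarrow> \<kappa> Z \<in> Hom A (fob \<mu> (fob f_sh Z)) (fob \<mu>' (fob f_sh Z))"
    and \<iota>'_\<kappa>: "\<And>Z. Z \<in> Ob D \<Longrightarrow>
      Comp A (fob \<mu> (fob f_sh Z)) (fob \<mu>' (fob f_sh Z)) (fob f_st Z) (\<iota>' Z) (\<kappa> Z) = \<iota> Z"
    by metis
  have \<kappa>_nat: "Comp A (fob \<mu> (fob f_sh Z)) (fob \<mu> (fob f_sh W)) (fob \<mu>' (fob f_sh W)) (\<kappa> W)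
        (fmor \<mu> (fob f_sh Z) (fob f_sh W) g) =
      Comp A (fob \<mu> (fob f_sh Z)) (fob \<mu>' (fob f_sh Z)) (fob \<mu>' (fob f_sh W))
        (fmor \<mu>' (fob f_sh Z) (fob f_sh W) g) (\<kappa> Z)"
    if Z: "Z \<in> Ob D" and W: "W \<in> Ob D" and g: "g \<in> Hom A (fob f_sh Z) (fob f_sh W)" for Z W g
    by (rule iso_cancel_left[OF restrictsD(2)[OF r' W], where X = "fob \<mu> (fob f_sh Z)"])
      (use Z W g in \<open>simp_all add: comp_assoc[symmetric] \<iota>'_\<kappa> restrictsD(3)[OF r] restrictsD(3)[OF r']\<close>,
       simp_all add: comp_assoc \<iota>'_\<kappa>)
  let ?d = "\<lambda>X. Comp A (fob \<mu> (P X)) (fob \<mu>' (P X)) (fob \<mu>' X) (fmor \<mu>' (P X) X (\<epsilon>\<^sub>1 X)) (\<kappa> (fob f_up X))"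
  have "\<exists>z. z \<in> Hom A (fob \<mu> X) (fob \<mu>' X) \<and>
      Comp A (fob \<mu> (P X)) (fob \<mu> X) (fob \<mu>' X) z (fmor \<mu> (P X) X (\<epsilon>\<^sub>1 X)) = ?d X" if X: "X \<in> Ob A" for X
  proof -
    have q: "is_cokernel A (fob \<mu> (fob f_sh (S X))) (fob \<mu> (P X)) (fmor \<mu> (fob f_sh (S X)) (P X) (rel X))
        (fob \<mu> X) (fmor \<mu> (P X) X (\<epsilon>\<^sub>1 X))"
      using e X by (simp add: presented_extension_def)
    have "Comp A (fob \<mu> (fob f_sh (S X))) (fob \<mu> (P X)) (fob \<mu>' X) (?d X) (fmor \<mu> (fob f_sh (S X)) (P X) (rel X)) =
        Comp A (fob \<mu> (fob f_sh (S X))) (fob \<mu>' (fob f_sh (S X))) (fob \<mu>' X)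
          (fmor \<mu>' (fob f_sh (S X)) X (Comp A (fob f_sh (S X)) (P X) X (\<epsilon>\<^sub>1 X) (rel X))) (\<kappa> (S X))"
      using X by (simp add: comp_assoc \<kappa>_nat m'.fmor_comp del: rel_zero)
    also have "\<dots> = zero_mor A (fob \<mu> (fob f_sh (S X))) (fob \<mu>' X)" using X by simp
    finally have dz: "Comp A (fob \<mu> (fob f_sh (S X))) (fob \<mu> (P X)) (fob \<mu>' X) (?d X)
        (fmor \<mu> (fob f_sh (S X)) (P X) (rel X)) = zero_mor A (fob \<mu> (fob f_sh (S X))) (fob \<mu>' X)" .
    have d: "?d X \<in> Hom A (fob \<mu> (P X)) (fob \<mu>' X)" using X by simp
    show ?thesis by (rule cokernel_factor[OF q m'.fob_in_Ob[OF X] d dz]) blast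
  qed
  then obtain \<zeta> where \<zeta> [simp]: "\<And>X. X \<in> Ob A \<Longrightarrow> \<zeta> X \<in> Hom A (fob \<mu> X) (fob \<mu>' X)"
    and \<zeta>_cover: "\<And>X. X \<in> Ob A \<Longrightarrow>
      Comp A (fob \<mu> (P X)) (fob \<mu> X) (fob \<mu>' X) (\<zeta> X) (fmor \<mu> (P X) X (\<epsilon>\<^sub>1 X)) = ?d X"
    by metis
  have \<zeta>_nat: "Comp A (fob \<mu> X) (fob \<mu> Y) (fob \<mu>' Y) (\<zeta> Y) (fmor \<mu> X Y a) =
      Comp A (fob \<mu> X) (fob \<mu>' X) (fob \<mu>' Y) (fmor \<mu>' X Y a) (\<zeta> X)"
    if X: "X \<in> Ob A" and Y: "Y \<in> Ob A" and a: "a \<in> Hom A X Y" for X Y a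
  proof (rule epi_cancel[OF presented_epi[OF e X], where Z = "fob \<mu>' Y"])
    let ?Pa = "fmor f_sh (fob f_up X) (fob f_up Y) (fmor f_up X Y a)"
    have "Comp A (fob \<mu> (P X)) (fob \<mu> X) (fob \<mu>' Y) (Comp A (fob \<mu> X) (fob \<mu> Y) (fob \<mu>' Y) (\<zeta> Y) (fmor \<mu> X Y a))
          (fmor \<mu> (P X) X (\<epsilon>\<^sub>1 X)) =
        Comp A (fob \<mu> (P X)) (fob \<mu> Y) (fob \<mu>' Y) (\<zeta> Y) (fmor \<mu> (P X) Y (Comp A (P X) (P Y) Y (\<epsilon>\<^sub>1 Y) ?Pa))"
      using X Y a by (simp add: comp_assoc m.fmor_comp[symmetric] sh.counit_natural)
    also have "\<dots> = Comp A (fob \<mu> (P X)) (fob \<mu> (P Y)) (fob \<mu>' Y) (?d Y) (fmor \<mu> (P X) (P Y) ?Pa)"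
      using X Y a by (simp add: m.fmor_comp \<zeta>_cover[symmetric] comp_assoc del: sh.counit_natural)
    also have "\<dots> = Comp A (fob \<mu> (P X)) (fob \<mu>' (P X)) (fob \<mu>' Y)
        (fmor \<mu>' (P X) Y (Comp A (P X) (P Y) Y (\<epsilon>\<^sub>1 Y) ?Pa)) (\<kappa> (fob f_up X))"
      using X Y a by (simp add: comp_assoc \<kappa>_nat m'.fmor_comp)
    also have "\<dots> = Comp A (fob \<mu> (P X)) (fob \<mu>' X) (fob \<mu>' Y) (fmor \<mu>' X Y a) (?d X)"
      using X Y a by (simp add: sh.counit_natural m'.fmor_comp comp_assoc)
    also have "\<dots> = Comp A (fob \<mu> (P X)) (fob \<mu> X) (fob \<mu>' Y)
        (Comp A (fob \<mu> X) (fob \<mu>' X) (fob \<mu>' Y) (fmor \<mu>' X Y a) (\<zeta> X)) (fmor \<mu> (P X) X (\<epsilon>\<^sub>1 X))"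
      using X Y a by (simp add: comp_assoc \<zeta>_cover)
    finally show "Comp A (fob \<mu> (P X)) (fob \<mu> X) (fob \<mu>' Y) (Comp A (fob \<mu> X) (fob \<mu> Y) (fob \<mu>' Y) (\<zeta> Y) (fmor \<mu> X Y a))
          (fmor \<mu> (P X) X (\<epsilon>\<^sub>1 X)) = Comp A (fob \<mu> (P X)) (fob \<mu> X) (fob \<mu>' Y)
        (Comp A (fob \<mu> X) (fob \<mu>' X) (fob \<mu>' Y) (fmor \<mu>' X Y a) (\<zeta> X)) (fmor \<mu> (P X) X (\<epsilon>\<^sub>1 X))" .
  qed (use X Y a in simp_all)
  \<comment> \<open>\<open>f_sh Z\<close> now has two candidate components: the induced one and \<open>\<kappa> Z\<close>. They agree
    because \<open>\<kappa>\<close> is natural for the cover of \<open>f_sh Z\<close>, itself a morphism of \<open>im f_sh\<close>.\<close>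
  have "\<zeta> (fob f_sh Z) = \<kappa> Z" if Z: "Z \<in> Ob D" for Z
    by (rule epi_cancel[OF presented_epi[OF e, of "fob f_sh Z"], where Z = "fob \<mu>' (fob f_sh Z)"])
      (use Z in \<open>simp_all add: \<zeta>_cover \<kappa>_nat\<close>)
  hence "identified \<mu> \<iota> \<mu>' \<iota>' \<zeta>" using \<iota>'_\<kappa> by (simp add: identified_def)
  moreover have "nat_trans A A \<mu> \<mu>' \<zeta>" using \<zeta>_nat by (simp add: nat_trans_def)
  ultimately show ?thesis using that by blast
qed

text \<open>
  The composite is a transformation from \<open>\<mu>\<close> to itself that respects the identification, and so is the
  identity; they agree by uniqueness.
\<close>

lemma identified_transformations_inverse:
  assumes e: "presented_extension \<mu> \<iota>" and e': "presented_extension \<mu>' \<iota>'"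
    and \<zeta>: "nat_trans A A \<mu> \<mu>' \<zeta>" "identified \<mu> \<iota> \<mu>' \<iota>' \<zeta>"
    and \<xi>: "nat_trans A A \<mu>' \<mu> \<xi>" "identified \<mu>' \<iota>' \<mu> \<iota> \<xi>"
    and X: "X \<in> Ob A"
  shows "Comp A (fob \<mu> X) (fob \<mu>' X) (fob \<mu> X) (\<xi> X) (\<zeta> X) = Ident A (fob \<mu> X)"
proof -
  interpret m: additive_functor A A \<mu> using e by (simp add: presented_extension_def)
  interpret m': additive_functor A A \<mu>' using e' by (simp add: presented_extension_def)
  let ?\<theta> = "\<lambda>X. Comp A (fob \<mu> X) (fob \<mu>' X) (fob \<mu> X) (\<xi> X) (\<zeta> X)"
  have r: "restricts_to A D f_sh f_st E \<mu> \<iota>" using e by (simp add: presented_extension_def)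
  have \<xi>_hom: "\<xi> Y \<in> Hom A (fob \<mu>' Y) (fob \<mu> Y)" if "Y \<in> Ob A" for Y
    using \<xi>(1) that by (simp add: nat_trans_def)
  note nat = \<zeta>(1)[unfolded nat_trans_def] \<xi>(1)[unfolded nat_trans_def]
  have "Comp A (fob \<mu> X) (fob \<mu> Y) (fob \<mu> Y) (?\<theta> Y) (fmor \<mu> X Y a) =
      Comp A (fob \<mu> X) (fob \<mu> X) (fob \<mu> Y) (fmor \<mu> X Y a) (?\<theta> X)"
    if XY: "X \<in> Ob A" "Y \<in> Ob A" and a: "a \<in> Hom A X Y" for X Y a
  proof -
    have "Comp A (fob \<mu> X) (fob \<mu> Y) (fob \<mu> Y) (?\<theta> Y) (fmor \<mu> X Y a) =
      Comp A (fob \<mu> X) (fob \<mu>' X) (fob \<mu> Y) (Comp A (fob \<mu>' X) (fob \<mu>' Y) (fob \<mu> Y) (\<xi> Y) (fmor \<mu>' X Y a)) (\<zeta> X)"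
      using nat(1) \<xi>_hom XY a by (simp add: comp_assoc)
    also have "\<dots> = Comp A (fob \<mu> X) (fob \<mu> X) (fob \<mu> Y) (fmor \<mu> X Y a) (?\<theta> X)"
      using nat XY a by (simp add: comp_assoc[symmetric])
    finally show ?thesis .
  qed
  hence 1: "nat_trans A A \<mu> \<mu> ?\<theta>" using nat by (simp add: nat_trans_def)
  have 2: "identified \<mu> \<iota> \<mu> \<iota> ?\<theta>"
    using nat \<zeta>(2) \<xi>(2) restrictsD(1)[OF r] by (simp add: identified_def comp_assoc[symmetric])
  have 3: "nat_trans A A \<mu> \<mu> (\<lambda>X. Ident A (fob \<mu> X))" by (simp add: nat_trans_def)
  have 4: "identified \<mu> \<iota> \<mu> \<iota> (\<lambda>X. Ident A (fob \<mu> X))"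
    using restrictsD(1)[OF r] by (simp add: identified_def)
  show ?thesis by (rule identified_transformation_unique[OF e e 1 2 3 4 X])
qed

lemma nakayama_presented:
  assumes "nakayama_functor A D f_sh f_up \<mu>" and "restricts_to A D f_sh f_st E \<mu> \<iota>"
  shows "presented_extension \<mu> \<iota>"
proof -
  obtain R \<eta> \<epsilon> where adj: "adjunction A A \<mu> R \<eta> \<epsilon>"
    using assms(1) unfolding nakayama_functor_def by blast
  interpret m: adjoint_pair A A \<mu> R \<eta> \<epsilon> using adjunction_imp_adjoint_pair[OF adj] .
  show ?thesis unfolding presented_extension_def
    using m.L.additive_functor_axioms assms(2) m.left_adjoint_preserves_cokernel[OF cover_is_cokernel] by simp
qed

text \<open>
  The sequence \<open>K \<rightarrow> P X \<rightarrow> X\<close> is short exact for the syzygy \<open>K\<close> of \<open>X\<close>, so its right half is preserved;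
  the same sequence for \<open>K\<close> instead of \<open>X\<close> shows that \<open>P K \<rightarrow> K\<close> stays an epimorphism.
\<close>

lemma right_exact_presented:
  assumes ex: "right_exact A A \<mu>" and "restricts_to A D f_sh f_st E \<mu> \<iota>"
  shows "presented_extension \<mu> \<iota>"
proof -
  interpret m: additive_functor A A \<mu> using ex by (simp add: right_exact_def)
  have ses: "exact_at A (fob \<mu> X) (fob \<mu> Y) (fob \<mu> Z) (fmor \<mu> X Y f) (fmor \<mu> Y Z g)"
    "is_epi A (fob \<mu> Y) (fob \<mu> Z) (fmor \<mu> Y Z g)"
    if "short_exact A X Y Z f g" "X \<in> Ob A" "Y \<in> Ob A" "Z \<in> Ob A" for X Y Z f g
    using ex that unfolding right_exact_def by blast+
  have cover: "short_exact A (fst (syz X)) (P X) X (snd (syz X)) (\<epsilon>\<^sub>1 X)" if "X \<in> Ob A" for X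
    by (rule short_exact_kernel_epi[OF cover_epi syz_kernel]) (use that in simp_all)
  have "is_cokernel A (fob \<mu> (fob f_sh (S X))) (fob \<mu> (P X)) (fmor \<mu> (fob f_sh (S X)) (P X) (rel X))
        (fob \<mu> X) (fmor \<mu> (P X) X (\<epsilon>\<^sub>1 X))" if X: "X \<in> Ob A" for X
  proof -
    have "is_cokernel A (fob \<mu> (fst (syz X))) (fob \<mu> (P X)) (fmor \<mu> (fst (syz X)) (P X) (snd (syz X)))
        (fob \<mu> X) (fmor \<mu> (P X) X (\<epsilon>\<^sub>1 X))"
      by (rule exact_epi_is_cokernel[OF ses[OF cover[OF X]]]) (use X in simp_all)
    moreover have "is_epi A (fob \<mu> (fob f_sh (S X))) (fob \<mu> (fst (syz X)))
        (fmor \<mu> (fob f_sh (S X)) (fst (syz X)) (\<epsilon>\<^sub>1 (fst (syz X))))"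
      by (rule ses(2)[OF cover[of "fst (syz X)"]]) (use X in simp_all)
    ultimately have "is_cokernel A (fob \<mu> (fob f_sh (S X))) (fob \<mu> (P X))
        (Comp A (fob \<mu> (fob f_sh (S X))) (fob \<mu> (fst (syz X))) (fob \<mu> (P X))
          (fmor \<mu> (fst (syz X)) (P X) (snd (syz X))) (fmor \<mu> (fob f_sh (S X)) (fst (syz X)) (\<epsilon>\<^sub>1 (fst (syz X)))))
        (fob \<mu> X) (fmor \<mu> (P X) X (\<epsilon>\<^sub>1 X))"
      by (rule cokernel_precomp_epi) (use X in simp_all)
    thus ?thesis using X by (simp add: rel_def m.fmor_comp)
  qed
  thus ?thesis unfolding presented_extension_def using m.additive_functor_axioms assms(2) by simp
qed

lemma identified_iso_ex1:
  assumes e: "presented_extension \<mu> \<iota>" and e': "presented_extension \<mu>' \<iota>'"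
  shows "\<exists>!\<zeta>. \<zeta> \<in> extensional (Ob A) \<and> nat_iso A A \<mu> \<mu>' \<zeta> \<and> identified \<mu> \<iota> \<mu>' \<iota>' \<zeta>"
proof -
  obtain \<zeta> where \<zeta>: "nat_trans A A \<mu> \<mu>' \<zeta>" "identified \<mu> \<iota> \<mu>' \<iota>' \<zeta>"
    using identified_transformation_exists[OF e e'] .
  obtain \<xi> where \<xi>: "nat_trans A A \<mu>' \<mu> \<xi>" "identified \<mu>' \<iota>' \<mu> \<iota> \<xi>"
    using identified_transformation_exists[OF e' e] .
  have iso: "is_iso A (fob \<mu> X) (fob \<mu>' X) (\<zeta> X)" if X: "X \<in> Ob A" for X
    unfolding is_iso_def
    using \<zeta>(1) \<xi>(1) X identified_transformations_inverse[OF e e' \<zeta> \<xi> X]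
      identified_transformations_inverse[OF e' e \<xi> \<zeta> X]
    by (intro conjI bexI[where x = "\<xi> X"]) (simp_all add: nat_trans_def)
  let ?\<zeta> = "restrict \<zeta> (Ob A)"
  show ?thesis
  proof (rule ex1I[of _ ?\<zeta>])
    have "nat_iso A A \<mu> \<mu>' ?\<zeta>"
      using \<zeta>(1) iso by (simp add: nat_iso_def nat_trans_def)
    moreover have "identified \<mu> \<iota> \<mu>' \<iota>' ?\<zeta>" using \<zeta>(2) by (simp add: identified_def)
    ultimately show "?\<zeta> \<in> extensional (Ob A) \<and> nat_iso A A \<mu> \<mu>' ?\<zeta> \<and> identified \<mu> \<iota> \<mu>' \<iota>' ?\<zeta>" by simp
  next
    fix \<theta> assume \<theta>: "\<theta> \<in> extensional (Ob A) \<and> nat_iso A A \<mu> \<mu>' \<theta> \<and> identified \<mu> \<iota> \<mu>' \<iota>' \<theta>"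
    show "\<theta> = ?\<zeta>"
    proof (rule extensionalityI[of _ "Ob A"])
      fix X assume "X \<in> Ob A"
      thus "\<theta> X = ?\<zeta> X"
        using identified_transformation_unique[OF e e' _ _ \<zeta>, of \<theta>] \<theta> by (simp add: nat_iso_def)
    qed (use \<theta> in simp_all)
  qed
qed

end

theorem proposition3p3p1:
  fixes A :: "('a, 'm) cat" and D :: "('d, 'n) cat"
    and f_sh :: "('d, 'n, 'a, 'm) functr"
    and f_up :: "('a, 'm, 'd, 'n) functr"
    and f_st :: "('d, 'n, 'a, 'm) functr"
    and E :: "('d, 'm, 'd, 'm) functr"
    and \<eta>\<^sub>1 :: "'d \<Rightarrow> 'n" and \<epsilon>\<^sub>1 :: "'a \<Rightarrow> 'm"
    and \<eta>\<^sub>2 :: "'a \<Rightarrow> 'm" and \<epsilon>\<^sub>2 :: "'d \<Rightarrow> 'n"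
  assumes "abelian_category A" and "additive_category D"
    and "adjunction D A f_sh f_up \<eta>\<^sub>1 \<epsilon>\<^sub>1"
    and "adjunction A D f_up f_st \<eta>\<^sub>2 \<epsilon>\<^sub>2"
    and "faithful A f_up"
    and "category_iso (im_category D A f_sh) (im_category D A f_st) E"
    and "functor_eq D (E \<circ>\<^sub>F to_im f_sh) (to_im f_st)"
  shows
    "(\<exists>\<nu> \<iota>. nakayama_functor A D f_sh f_up \<nu> \<and> restricts_to A D f_sh f_st E \<nu> \<iota>) \<and>
     (\<forall>\<nu> \<iota> \<nu>' \<iota>'.
        nakayama_functor A D f_sh f_up \<nu> \<and> restricts_to A D f_sh f_st E \<nu> \<iota> \<and>
        right_exact A A \<nu>' \<and> restricts_to A D f_sh f_st E \<nu>' \<iota>' \<longrightarrow>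
        (\<exists>!\<zeta>. \<zeta> \<in> extensional (Ob A) \<and> nat_iso A A \<nu> \<nu>' \<zeta> \<and>
           (\<forall>X \<in> Ob D.
              Comp A (fob \<nu> (fob f_sh X)) (fob \<nu>' (fob f_sh X)) (fob f_st X)
                (\<iota>' X) (\<zeta> (fob f_sh X)) = \<iota> X)))"
proof -
  interpret nakayama_setting A D f_sh f_up f_st \<eta>\<^sub>1 \<epsilon>\<^sub>1 \<eta>\<^sub>2 \<epsilon>\<^sub>2 E
    using assms by (intro nakayama_setting.intro nakayama_setting_axioms.intro adjunction_imp_adjoint_pair)
  show ?thesis
    using nu_nakayama nu_restricts identified_iso_ex1[OF nakayama_presented right_exact_presented]
    unfolding identified_def by blast
qed

end
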